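(* Let $g_0$ be a left invariant metric on the Heisenberg group $\mathrm{Nil}_3$, given with respect to a Milnor frame $\{F_1,F_2,F_3\}$ by $$g_0=A_0\,\theta^1\otimes\theta^1+B_0\,\theta^2\otimes\theta^2+C_0\,\theta^3\otimes\theta^3,\qquad A_0,B_0,C_0>0.$$ Let $g_t$, $t\in[0,\infty)$, be the solution of the Ricci flow with initial condition $g_0$. Then for every precompact domain $\Omega\subset\mathrm{Nil}_3$ with smooth boundary and every $t\in[0,\infty)$, $$\left(1+\frac{12A_0}{B_0C_0}t\right)^{-\frac16}\mathcal{T}(\Omega_0)\le\mathcal{T}(\Omega_t)\le\left(1+\frac{12A_0}{B_0C_0}t\right)^{\frac12}\mathcal{T}(\Omega_0).$$
   Context: $\mathrm{Nil}_3$ is the Lie group of real upper triangular $3\times3$ matrices with $1$'s on the diagonal. $\{F_i\}$ is a Milnor frame: left invariant vector fields in which the left invariant metric is diagonal, normalized so that (up to sign) $[F_2,F_3]=2F_1$ and all other brackets $[F_i,F_j]$, $i<j$, vanish; $\{\theta^i\}$ are the dual one-forms, $\theta^i(F_j)=\delta^i_j$. With this normalization, the Ricci tensor of $A\theta^1\otimes\theta^1+B\theta^2\otimes\theta^2+C\theta^3\otimes\theta^3$ is $\frac{2A^2}{BC}\theta^1\otimes\theta^1-\frac{2A}{C}\theta^2\otimes\theta^2-\frac{2A}{B}\theta^3\otimes\theta^3$. The Ricci flow is $\frac{\partial}{\partial t}g_t=-2\,\mathrm{Ric}_{g_t}$, and the solution meant is the one that stays left invariant, $g_t=A(t)\theta^1\otimes\theta^1+B(t)\theta^2\otimes\theta^2+C(t)\theta^3\otimes\theta^3$.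 The torsional rigidity is $\mathcal{T}(\Omega_t)=\int_\Omega E_t\,d\mathrm{V}_t$, where $d\mathrm{V}_t$ is the volume element of $g_t$ and $E_t$ solves $\Delta_{g_t}E_t=-1$ in $\Omega$, $E_t=0$ on $\partial\Omega$. *)

theory Defs
  imports "HOL-Analysis.Analysis"
begin

section \<open>Smoothness on open subsets of Euclidean space\<close>

definition partial_deriv :: "'n::finite \<Rightarrow> (real^'n \<Rightarrow> real) \<Rightarrow> real^'n \<Rightarrow> real" where
  "partial_deriv i f p = frechet_derivative f (at p) (axis i 1)"

text \<open>Meant for open \<open>U\<close>; the derivatives are the unrestricted ones.\<close>

fun Ck_on :: "nat \<Rightarrow> (real^'n::finite) set \<Rightarrow> (real^'n \<Rightarrow> real) \<Rightarrow> bool" where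
  "Ck_on 0 U f \<longleftrightarrow> continuous_on U f"
| "Ck_on (Suc k) U f \<longleftrightarrow>
     (\<forall>p\<in>U. f differentiable (at p)) \<and> (\<forall>i. Ck_on k U (partial_deriv i f))"

definition smooth_on :: "(real^'n::finite) set \<Rightarrow> (real^'n \<Rightarrow> real) \<Rightarrow> bool" where
  "smooth_on U f \<longleftrightarrow> (\<forall>k. Ck_on k U f)"

definition smooth_boundary :: "(real^'n::finite) set \<Rightarrow> bool" where
  "smooth_boundary \<Omega> \<longleftrightarrow>
     (\<forall>p\<in>frontier \<Omega>. \<exists>U \<rho>. open U \<and> p \<in> U \<and> smooth_on U \<rho> \<and>
        (\<exists>i. partial_deriv i \<rho> p \<noteq> 0) \<and> \<Omega> \<inter> U = {q\<in>U. \<rho> q < 0})"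

definition precompact_smooth_domain :: "(real^'n::finite) set \<Rightarrow> bool" where
  "precompact_smooth_domain \<Omega> \<longleftrightarrow>
     open \<Omega> \<and> connected \<Omega> \<and> \<Omega> \<noteq> {} \<and> compact (closure \<Omega>) \<and> smooth_boundary \<Omega>"

section \<open>Riemannian metrics in a global chart\<close>

text \<open>A field of bilinear forms is a function of the base point and of two tangent vectors.\<close>

type_synonym 'n vec_field = "real^'n \<Rightarrow> real^'n"
type_synonym 'n form2 = "real^'n \<Rightarrow> real^'n \<Rightarrow> real^'n \<Rightarrow> real"

definition riemannian_metric :: "'n::finite form2 \<Rightarrow> bool" where
  "riemannian_metric g \<longleftrightarrow>
     (\<forall>p. bilinear (g p)) \<and> (\<forall>p v w. g p v w = g p w v) \<and> (\<forall>p v. v \<noteq> 0 \<longrightarrow> g p v v > 0) \<and>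
     (\<forall>v w. smooth_on UNIV (\<lambda>p. g p v w))"

definition gram :: "'n::finite form2 \<Rightarrow> real^'n \<Rightarrow> real^'n^'n" where
  "gram g p = (\<chi> i j. g p (axis i 1) (axis j 1))"

definition gram_inv :: "'n::finite form2 \<Rightarrow> real^'n \<Rightarrow> real^'n^'n" where
  "gram_inv g p = matrix_inv (gram g p)"

text \<open>\<open>christoffel g k i j\<close> is \<open>\<Gamma>\<^sup>k\<^sub>i\<^sub>j\<close> of the Levi-Civita connection.\<close>

definition christoffel :: "'n::finite form2 \<Rightarrow> 'n \<Rightarrow> 'n \<Rightarrow> 'n \<Rightarrow> real^'n \<Rightarrow> real" where
  "christoffel g k i j p =
     (\<Sum>l\<in>UNIV. gram_inv g p $ k $ l *
        (partial_deriv i (\<lambda>q. gram g q $ j $ l) p + partial_deriv j (\<lambda>q. gram g q $ i $ l) p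
         - partial_deriv l (\<lambda>q. gram g q $ i $ j) p)) / 2"

text \<open>\<open>curvature g l k i j\<close> is the \<open>l\<close>-th component of \<open>R(\<partial>\<^sub>i, \<partial>\<^sub>j) \<partial>\<^sub>k\<close>, where
  \<open>R(X, Y) Z = \<nabla>\<^sub>X \<nabla>\<^sub>Y Z - \<nabla>\<^sub>Y \<nabla>\<^sub>X Z - \<nabla>\<^bsub>[X, Y]\<^esub> Z\<close>.\<close>

definition curvature :: "'n::finite form2 \<Rightarrow> 'n \<Rightarrow> 'n \<Rightarrow> 'n \<Rightarrow> 'n \<Rightarrow> real^'n \<Rightarrow> real" where
  "curvature g l k i j p =
     partial_deriv i (christoffel g l j k) p - partial_deriv j (christoffel g l i k) p
     + (\<Sum>m\<in>UNIV. christoffel g l i m p * christoffel g m j k p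
                 - christoffel g l j m p * christoffel g m i k p)"

text \<open>\<open>Ric(v, w)\<close> is the trace of \<open>u \<mapsto> R(u, v) w\<close>.\<close>

definition ricci :: "'n::finite form2 \<Rightarrow> 'n form2" where
  "ricci g p v w =
     (\<Sum>j\<in>UNIV. \<Sum>k\<in>UNIV. v $ j * w $ k * (\<Sum>i\<in>UNIV. curvature g i k i j p))"

definition ricci_flow_on :: "real set \<Rightarrow> (real \<Rightarrow> 'n::finite form2) \<Rightarrow> bool" where
  "ricci_flow_on I g \<longleftrightarrow>
     (\<forall>t\<in>I. riemannian_metric (g t)) \<and>
     (\<forall>t\<in>I. \<forall>p v w. ((\<lambda>s. g s p v w) has_real_derivative - 2 * ricci (g t) p v w) (at t within I))"

definition volume_density :: "'n::finite form2 \<Rightarrow> real^'n \<Rightarrow> real" where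
  "volume_density g p = sqrt (det (gram g p))"

definition volume_measure :: "'n::finite form2 \<Rightarrow> (real^'n) measure" where
  "volume_measure g = density lborel (\<lambda>p. ennreal (volume_density g p))"

definition gradient :: "'n::finite form2 \<Rightarrow> (real^'n \<Rightarrow> real) \<Rightarrow> 'n vec_field" where
  "gradient g f p = (\<chi> i. \<Sum>j\<in>UNIV. gram_inv g p $ i $ j * partial_deriv j f p)"

definition divergence :: "'n::finite form2 \<Rightarrow> 'n vec_field \<Rightarrow> real^'n \<Rightarrow> real" where
  "divergence g X p =
     (\<Sum>i\<in>UNIV. partial_deriv i (\<lambda>q. volume_density g q * X q $ i) p) / volume_density g p"

definition laplacian :: "'n::finite form2 \<Rightarrow> (real^'n \<Rightarrow> real) \<Rightarrow> real^'n \<Rightarrow> real" where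
  "laplacian g f = divergence g (gradient g f)"

section \<open>Torsional rigidity\<close>

definition torsion_function :: "'n::finite form2 \<Rightarrow> (real^'n) set \<Rightarrow> (real^'n \<Rightarrow> real) \<Rightarrow> bool" where
  "torsion_function g \<Omega> E \<longleftrightarrow>
     Ck_on 2 \<Omega> E \<and> continuous_on (closure \<Omega>) E \<and>
     (\<forall>p\<in>\<Omega>. laplacian g E p = - 1) \<and> (\<forall>p\<in>frontier \<Omega>. E p = 0)"

text \<open>The torsional rigidity as a relation, in the style of \<^const>\<open>has_integral\<close>: its value is the
  integral of a classical solution of the Dirichlet problem. On a precompact smooth domain the
  solution exists and is unique, so there is exactly one value.\<close>

definition has_torsional_rigidity :: "'n::finite form2 \<Rightarrow> (real^'n) set \<Rightarrow> real \<Rightarrow> bool" where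
  "has_torsional_rigidity g \<Omega> \<tau> \<longleftrightarrow>
     (\<exists>E. torsion_function g \<Omega> E \<and> \<tau> = (LINT p:\<Omega>|volume_measure g. E p))"

section \<open>The Heisenberg group\<close>

text \<open>Indices are written out because \<open>3 = 0\<close> in the numeral type \<open>3\<close>.\<close>

definition nil3 :: "(real^3^3) set" where
  "nil3 = {M. M$1$1 = 1 \<and> M$2$2 = 1 \<and> M$3$3 = 1 \<and> M$2$1 = 0 \<and> M$3$1 = 0 \<and> M$3$2 = 0}"

text \<open>The group is used through its global chart \<open>nil3_matrix\<close>, in which \<open>nil3_mult\<close> is the
  matrix product.\<close>

definition nil3_matrix :: "real^3 \<Rightarrow> real^3^3" where
  "nil3_matrix p = vector [vector [1, p$1, p$3], vector [0, 1, p$2], vector [0, 0, 1]]"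

definition nil3_mult :: "real^3 \<Rightarrow> real^3 \<Rightarrow> real^3" where
  "nil3_mult p q = vector [p$1 + q$1, p$2 + q$2, p$3 + q$3 + p$1 * q$2]"

lemma bij_betw_nil3_matrix: "bij_betw nil3_matrix UNIV nil3"
proof (rule bij_betwI[where g = "\<lambda>M. vector [M$1$2, M$2$3, M$1$3]"])
  show "nil3_matrix \<in> UNIV \<rightarrow> nil3"
    by (auto simp: nil3_matrix_def nil3_def)
qed (auto simp: nil3_matrix_def nil3_def vec_eq_iff forall_3)

lemma nil3_matrix_mult: "nil3_matrix (nil3_mult p q) = nil3_matrix p ** nil3_matrix q"
  by (simp add: nil3_matrix_def nil3_mult_def matrix_matrix_mult_def vec_eq_iff forall_3 sum_3)

definition left_invariant :: "3 vec_field \<Rightarrow> bool" where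
  "left_invariant X \<longleftrightarrow>
     (\<forall>p q. X (nil3_mult p q) = frechet_derivative (nil3_mult p) (at q) (X q))"

definition lie_bracket :: "'n::finite vec_field \<Rightarrow> 'n vec_field \<Rightarrow> 'n vec_field" where
  "lie_bracket X Y p = frechet_derivative Y (at p) (X p) - frechet_derivative X (at p) (Y p)"

definition dual_coframe :: "('n::finite \<Rightarrow> 'n vec_field) \<Rightarrow> ('n \<Rightarrow> real^'n \<Rightarrow> real^'n \<Rightarrow> real) \<Rightarrow> bool"
  where
  "dual_coframe F \<theta> \<longleftrightarrow>
     (\<forall>i p. linear (\<theta> i p)) \<and> (\<forall>i j p. \<theta> i p (F j p) = (if i = j then 1 else 0))"

text \<open>The factor \<open>\<sigma>\<close> is the sign up to which the frame is normalized. Linear independence of the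
  frame follows from the existence of a dual coframe.\<close>

definition milnor_frame :: "(3 \<Rightarrow> 3 vec_field) \<Rightarrow> (3 \<Rightarrow> real^3 \<Rightarrow> real^3 \<Rightarrow> real) \<Rightarrow> bool" where
  "milnor_frame F \<theta> \<longleftrightarrow>
     (\<forall>i. left_invariant (F i)) \<and> dual_coframe F \<theta> \<and>
     (\<exists>\<sigma>\<in>{1, - 1}. \<forall>p. lie_bracket (F 2) (F 3) p = (2 * \<sigma>) *\<^sub>R F 1 p) \<and>
     (\<forall>p. lie_bracket (F 1) (F 2) p = 0) \<and> (\<forall>p. lie_bracket (F 1) (F 3) p = 0)"

definition diagonal_metric ::
  "(3 \<Rightarrow> real^3 \<Rightarrow> real^3 \<Rightarrow> real) \<Rightarrow> real \<Rightarrow> real \<Rightarrow> real \<Rightarrow> 3 form2" where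
  "diagonal_metric \<theta> A B C p v w =
     A * (\<theta> 1 p v * \<theta> 1 p w) + B * (\<theta> 2 p v * \<theta> 2 p w) + C * (\<theta> 3 p v * \<theta> 3 p w)"

end

theory Submission
  imports Defs
begin

text \<open>In a Milnor frame the Ricci flow is the system \<open>A' = - 4 A\<^sup>2 / (B C)\<close>, \<open>B' = 4 A / C\<close>,
  \<open>C' = 4 A / B\<close>. It conserves \<open>A B\<close> and \<open>A C\<close>, and \<open>1 / A\<^sup>3\<close> grows linearly; so with
  \<open>s = 1 + 12 A\<^sub>0 t / (B\<^sub>0 C\<^sub>0)\<close> and \<open>r\<close> the cube root of \<open>s\<close> one gets \<open>A = A\<^sub>0 / r\<close>, \<open>B = B\<^sub>0 r\<close>,
  \<open>C = C\<^sub>0 r\<close>. The volume element is multiplied by the square root of \<open>r\<close>, and the inverse metric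
  changes by a factor between \<open>1 / r\<close> and \<open>r\<close>.

  Torsion integrals are compared by the complementary variational principle. If
  \<open>div (M \<nabla>u) = - 1 = div (N \<nabla>v)\<close> and \<open>N \<ge> m M\<close>, then testing both equations with \<open>v\<close> gives
  \<open>2 \<integral>v = 2 \<integral>M(\<nabla>u, \<nabla>v) \<le> \<integral>N(\<nabla>v, \<nabla>v) + (1 / m) \<integral>M(\<nabla>u, \<nabla>u) = \<integral>v + (1 / m) \<integral>u\<close>. As the
  solutions are only continuous up to the boundary, the test functions are truncations of \<open>v\<close>
  and \<open>u\<close> with compact support in the domain.\<close>

section \<open>Partial derivatives\<close>

lemma partial_deriv_eq:
  "(f has_derivative D) (at p) \<Longrightarrow> partial_deriv i f p = D (axis i 1)"
  by (simp add: partial_deriv_def frechet_derivative_at[symmetric])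

lemma has_frechet_derivative:
  "f differentiable (at p) \<Longrightarrow> (f has_derivative frechet_derivative f (at p)) (at p)"
  by (simp add: frechet_derivative_works)

lemma partial_deriv_cong_open:
  assumes "open U" "p \<in> U" "\<And>q. q \<in> U \<Longrightarrow> f q = g q"
  shows "partial_deriv i f p = partial_deriv i g p"
proof -
  \<comment> \<open>\<open>frechet_derivative\<close> is a choice among the derivatives at the
    point, so it suffices that \<open>f\<close> and \<open>g\<close> have the same ones. This covers
    points where there is none.\<close>
  have "(f has_derivative D) (at p) \<longleftrightarrow> (g has_derivative D) (at p)" for D
    using has_derivative_transform_within_open[OF _ assms(1,2)] assms(3) by metis
  then show ?thesis
    by (simp add: partial_deriv_def frechet_derivative_def)
qed

lemma partial_deriv_eq_0:
  assumes "open U" "p \<in> U" "\<And>q. q \<in> U \<Longrightarrow> f q = 0"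
  shows "partial_deriv i f p = 0"
  using partial_deriv_cong_open[OF assms(1,2), of f "\<lambda>_. 0" i] assms(3)
  by (simp add: partial_deriv_def)

lemma partial_deriv_mult:
  assumes "f differentiable (at p)" "g differentiable (at p)"
  shows "partial_deriv i (\<lambda>q. f q * g q) p = partial_deriv i f p * g p + f p * partial_deriv i g p"
  using partial_deriv_eq[OF has_derivative_mult[OF assms[THEN has_frechet_derivative]], of i]
  by (simp add: partial_deriv_def)

lemma partial_deriv_sum:
  assumes "\<And>j. j \<in> J \<Longrightarrow> f j differentiable (at p)"
  shows "partial_deriv i (\<lambda>q. \<Sum>j\<in>J. f j q) p = (\<Sum>j\<in>J. partial_deriv i (f j) p)"
  using partial_deriv_eq[OF has_derivative_sum[of J f "\<lambda>j. frechet_derivative (f j) (at p)" "at p"], of i]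
    assms has_frechet_derivative
  by (auto simp: partial_deriv_def)

lemma has_derivative_compose_real:
  fixes u :: "'a::real_normed_vector \<Rightarrow> real"
  assumes "u differentiable (at p)" "(\<phi> has_real_derivative d) (at (u p))"
  shows "((\<lambda>q. \<phi> (u q)) has_derivative (\<lambda>h. d * frechet_derivative u (at p) h)) (at p)"
  using has_derivative_compose[OF has_frechet_derivative[OF assms(1)]] assms(2)
  by (simp add: has_field_derivative_def frechet_derivative_works)

lemma partial_deriv_compose:
  assumes "u differentiable (at p)" "(\<phi> has_real_derivative d) (at (u p))"
  shows "partial_deriv i (\<lambda>q. \<phi> (u q)) p = d * partial_deriv i u p"
  using partial_deriv_eq[OF has_derivative_compose_real[OF assms]] by (simp add: partial_deriv_def)

lemma has_real_derivative_along_axis: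
  assumes "f differentiable (at (p + s *\<^sub>R axis i 1))"
  shows "((\<lambda>r. f (p + r *\<^sub>R axis i 1)) has_real_derivative
    partial_deriv i f (p + s *\<^sub>R axis i 1)) (at s)"
proof -
  let ?D = "frechet_derivative f (at (p + s *\<^sub>R axis i 1))"
  have D: "(f has_derivative ?D) (at (p + s *\<^sub>R axis i 1))"
    using assms by (rule has_frechet_derivative)
  have "((\<lambda>r. p + r *\<^sub>R axis i 1) has_derivative (\<lambda>r. r *\<^sub>R axis i 1)) (at s)"
    by (auto intro!: derivative_eq_intros)
  from has_derivative_compose[OF this D] show ?thesis
    using linear_cmul[OF has_derivative_linear[OF D]]
    by (simp add: has_field_derivative_def partial_deriv_def mult.commute[of _ "?D _"])
qed

section \<open>Closure properties of the class \<open>Ck_on 1\<close>\<close>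

lemma Ck_on_1: "Ck_on 1 U f \<longleftrightarrow> (\<forall>p\<in>U. f differentiable (at p)) \<and> (\<forall>i. continuous_on U (partial_deriv i f))"
  by (simp add: One_nat_def)

lemma Ck_on_2: "Ck_on 2 U f \<longleftrightarrow> (\<forall>p\<in>U. f differentiable (at p)) \<and> (\<forall>i. Ck_on 1 U (partial_deriv i f))"
  by (simp add: numeral_2_eq_2)

lemma Ck_on_1_continuous: "Ck_on 1 U f \<Longrightarrow> continuous_on U f"
  unfolding Ck_on_1
  by (meson continuous_at_imp_continuous_on differentiable_imp_continuous_within)

lemma Ck_on_2_imp_1: "Ck_on 2 U f \<Longrightarrow> Ck_on 1 U f"
  unfolding Ck_on_2 using Ck_on_1_continuous Ck_on_1 by blast

lemma Ck_on_1_mult: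
  assumes "Ck_on 1 U f" "Ck_on 1 U g"
  shows "Ck_on 1 U (\<lambda>p. f p * g p)"
proof -
  have "continuous_on U (\<lambda>p. partial_deriv i f p * g p + f p * partial_deriv i g p)" for i
    using assms Ck_on_1_continuous unfolding Ck_on_1 by (intro continuous_intros) auto
  moreover have "partial_deriv i (\<lambda>p. f p * g p) p = partial_deriv i f p * g p + f p * partial_deriv i g p"
    if "p \<in> U" for i p
    using assms that by (intro partial_deriv_mult) (auto simp: Ck_on_1)
  ultimately have "continuous_on U (partial_deriv i (\<lambda>p. f p * g p))" for i
    by (simp cong: continuous_on_cong_simp)
  then show ?thesis
    using assms by (auto simp: Ck_on_1)
qed

lemma Ck_on_1_sum:
  assumes "\<And>j. j \<in> J \<Longrightarrow> Ck_on 1 U (f j)" "finite J"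
  shows "Ck_on 1 U (\<lambda>p. \<Sum>j\<in>J. f j p)"
proof -
  have "continuous_on U (\<lambda>p. \<Sum>j\<in>J. partial_deriv i (f j) p)" for i
    using assms unfolding Ck_on_1 by (intro continuous_intros) auto
  moreover have "partial_deriv i (\<lambda>p. \<Sum>j\<in>J. f j p) p = (\<Sum>j\<in>J. partial_deriv i (f j) p)"
    if "p \<in> U" for i p
    using assms that by (intro partial_deriv_sum) (auto simp: Ck_on_1)
  ultimately have "continuous_on U (partial_deriv i (\<lambda>p. \<Sum>j\<in>J. f j p))" for i
    by (simp cong: continuous_on_cong_simp)
  then show ?thesis
    using assms by (auto simp: Ck_on_1 intro!: differentiable_sum)
qed

lemma Ck_on_1_compose:
  assumes "Ck_on 1 U u" "\<And>x. (\<phi> has_real_derivative \<phi>' x) (at x)" "continuous_on UNIV \<phi>'"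
  shows "Ck_on 1 U (\<lambda>p. \<phi> (u p))"
proof -
  have "continuous_on U (\<lambda>p. \<phi>' (u p) * partial_deriv i u p)" for i
    using assms Ck_on_1_continuous[OF assms(1)] unfolding Ck_on_1
    by (intro continuous_intros continuous_on_compose2[OF assms(3)]) auto
  moreover have "partial_deriv i (\<lambda>p. \<phi> (u p)) p = \<phi>' (u p) * partial_deriv i u p"
    if "p \<in> U" for i p
    using assms that by (intro partial_deriv_compose) (auto simp: Ck_on_1)
  ultimately have "continuous_on U (partial_deriv i (\<lambda>p. \<phi> (u p)))" for i
    by (simp cong: continuous_on_cong_simp)
  then show ?thesis
    using assms(1) has_derivative_compose_real[OF _ assms(2)]
    unfolding Ck_on_1 by (blast intro: differentiableI)
qed

section \<open>Integration by parts\<close>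

lemma integral_translation_lborel:
  fixes h :: "'a::euclidean_space \<Rightarrow> real"
  assumes "h \<in> borel_measurable borel"
  shows "(LINT p|lborel. h (v + p)) = (LINT p|lborel. h p)"
  using integral_distr[of "(+) v" lborel borel h] assms by (simp add: lborel_distr_plus)

text \<open>The difference quotients of \<open>h\<close> have integral 0 by translation invariance.
  They converge to the partial derivative, and they are dominated because that derivative is bounded
  and \<open>h\<close> has compact support.\<close>

lemma integral_partial_deriv_eq_0:
  fixes h :: "real^'n \<Rightarrow> real"
  assumes diff: "\<And>p. h differentiable (at p)"
    and cont: "continuous_on UNIV (partial_deriv i h)"
    and K: "compact K" "\<And>p. p \<notin> K \<Longrightarrow> h p = 0"
  shows "(LINT p|lborel. partial_deriv i h p) = 0"
proof -
  let ?e = "axis i 1 :: real^'n"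
  define d where "d n = inverse (real (Suc n))" for n
  define q where "q n p = (h (d n *\<^sub>R ?e + p) - h p) / d n" for n p
  have d: "d n > 0" "d n \<le> 1" for n
    by (auto simp: d_def field_simps)
  have d_lim: "d \<longlonglongrightarrow> 0"
    unfolding d_def by (rule LIMSEQ_inverse_real_of_nat)
  have deriv: "((\<lambda>r. h (p + r *\<^sub>R ?e)) has_real_derivative partial_deriv i h (p + s *\<^sub>R ?e)) (at s)"
    for p s
    using diff by (intro has_real_derivative_along_axis)
  have off: "partial_deriv i h p = 0" if "p \<notin> K" for p
    using K that compact_imp_closed by (intro partial_deriv_eq_0[of "- K"]) auto
  obtain M where M: "\<And>p. \<bar>partial_deriv i h p\<bar> \<le> M" "M \<ge> 0"
  proof -
    have "compact (partial_deriv i h ` K)"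
      using cont K compact_continuous_image continuous_on_subset by blast
    then obtain M where "\<And>p. p \<in> K \<Longrightarrow> \<bar>partial_deriv i h p\<bar> \<le> M" "M > 0"
      by (force dest!: compact_imp_bounded simp: bounded_pos)
    then show ?thesis
      using off by (intro that[of M]) force+
  qed
  obtain r where r: "K \<subseteq> cball 0 r"
    using compact_imp_bounded[OF K(1)] by (auto simp: bounded_iff subset_eq)
  have h_borel: "h \<in> borel_measurable borel"
    using diff by (intro borel_measurable_continuous_onI)
      (simp add: continuous_at_imp_continuous_on differentiable_imp_continuous_within)
  have h_int: "integrable lborel h"
  proof -
    have "continuous_on K h"
      using diff by (simp add: continuous_at_imp_continuous_on differentiable_imp_continuous_within)
    from borel_integrable_compact[OF K(1) this]
    have "integrable lborel (\<lambda>p. indicator K p *\<^sub>R h p)" .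
    moreover have "(\<lambda>p. indicator K p *\<^sub>R h p) = h"
      using K(2) by (intro ext) (auto simp: indicator_def)
    ultimately show ?thesis by simp
  qed
  have h_int': "integrable lborel (\<lambda>p. h (v + p))" for v
    using integrable_distr_eq[of "(+) v" lborel borel h] h_int h_borel
    by (simp add: lborel_distr_plus)
  have "(\<lambda>n. LINT p|lborel. q n p) \<longlonglongrightarrow> (LINT p|lborel. partial_deriv i h p)"
  proof (rule integral_dominated_convergence)
    show "partial_deriv i h \<in> borel_measurable lborel"
      using cont by (simp add: borel_measurable_continuous_onI)
    show "q n \<in> borel_measurable lborel" for n
      unfolding q_def using h_borel by measurable
    \<comment> \<open>The shifts \<open>d n\<close> are at most 1, so the quotients vanish outside
      the ball of radius \<open>r + 1\<close>; inside it the mean value inequality bounds them by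
      \<open>M\<close>.\<close>
    show "integrable lborel (\<lambda>p. indicator (cball 0 (r + 1)) p *\<^sub>R M)"
      by (rule borel_integrable_compact) auto
    show "AE p in lborel. (\<lambda>n. q n p) \<longlonglongrightarrow> partial_deriv i h p"
    proof (rule AE_I2)
      fix p
      have "(\<lambda>s. (h (p + s *\<^sub>R ?e) - h p) / s) \<midarrow>0\<rightarrow> partial_deriv i h p"
        using deriv[of p 0] by (simp add: DERIV_def)
      then have "(\<lambda>n. (h (p + d n *\<^sub>R ?e) - h p) / d n) \<longlonglongrightarrow> partial_deriv i h p"
        unfolding LIMSEQ_SEQ_conv[symmetric]
        using d_lim d(1) by (simp add: less_imp_neq[symmetric])
      then show "(\<lambda>n. q n p) \<longlonglongrightarrow> partial_deriv i h p"
        by (simp add: q_def add.commute)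
    qed
    show "AE p in lborel. norm (q n p) \<le> indicator (cball 0 (r + 1)) p *\<^sub>R M" for n
    proof (rule AE_I2)
      fix p
      show "norm (q n p) \<le> indicator (cball 0 (r + 1)) p *\<^sub>R M"
      proof (cases "p \<in> cball 0 (r + 1)")
        case True
        have "norm (h (p + d n *\<^sub>R ?e) - h (p + 0 *\<^sub>R ?e)) \<le> M * norm (d n - 0)"
          using field_differentiable_bound[of UNIV "\<lambda>r. h (p + r *\<^sub>R ?e)"
              "\<lambda>s. partial_deriv i h (p + s *\<^sub>R ?e)" M "d n" 0] deriv M(1)
          by simp
        then show ?thesis
          using True d(1)[of n] by (simp add: q_def field_simps add.commute)
      next
        case False
        have "norm p \<le> norm (d n *\<^sub>R ?e + p) + norm (d n *\<^sub>R ?e)"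
          using norm_triangle_ineq4[of "d n *\<^sub>R ?e + p" "d n *\<^sub>R ?e"] by simp
        then have "norm p \<le> norm (d n *\<^sub>R ?e + p) + 1"
          using d[of n] by (simp add: norm_axis_1)
        then have "p \<notin> K" "d n *\<^sub>R ?e + p \<notin> K"
          using r False by (auto simp: subset_eq)
        then show ?thesis
          using K(2) M(2) by (simp add: q_def)
      qed
    qed
  qed
  moreover have "(LINT p|lborel. q n p) = 0" for n
    using h_int h_int' integral_translation_lborel[OF h_borel] by (simp add: q_def)
  ultimately show ?thesis
    using LIMSEQ_unique by (simp add: tendsto_const_iff)
qed

text \<open>\<open>k\<close> may be unbounded near the frontier of \<open>\<Omega>\<close>; only its
  values on \<open>K\<close> enter.\<close>

lemma set_integrable_compact_support:
  fixes k :: "'a::euclidean_space \<Rightarrow> real"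
  assumes "continuous_on \<Omega> k" "compact K" "K \<subseteq> \<Omega>" "\<And>p. p \<in> \<Omega> - K \<Longrightarrow> k p = 0"
  shows "set_integrable lborel \<Omega> k"
proof -
  have "integrable lborel (\<lambda>p. indicator K p *\<^sub>R k p)"
    using assms by (intro borel_integrable_compact) (auto intro: continuous_on_subset)
  moreover have "(\<lambda>p. indicator K p *\<^sub>R k p) = (\<lambda>p. indicator \<Omega> p *\<^sub>R k p)"
    using assms(3,4) by (intro ext) (auto simp: indicator_def)
  ultimately show ?thesis
    by (simp add: set_integrable_def)
qed

text \<open>The product \<open>f Y\<close>, extended by 0, has continuous first derivatives on the
  whole space, so \<open>integral_partial_deriv_eq_0\<close> applies to it.\<close>

lemma integral_by_parts_component:
  fixes f Y :: "real^'n \<Rightarrow> real"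
  assumes "open \<Omega>" "compact K" "K \<subseteq> \<Omega>"
    and f: "Ck_on 1 \<Omega> f" "\<And>p. p \<in> \<Omega> - K \<Longrightarrow> f p = 0"
    and Y: "Ck_on 1 \<Omega> Y"
  shows "(LINT p:\<Omega>|lborel. partial_deriv i f p * Y p) = - (LINT p:\<Omega>|lborel. f p * partial_deriv i Y p)"
proof -
  define h where "h p = (if p \<in> \<Omega> then f p * Y p else 0)" for p
  have fY: "Ck_on 1 \<Omega> (\<lambda>p. f p * Y p)"
    using f(1) Y by (rule Ck_on_1_mult)
  have "open (- K)"
    using assms(2) compact_imp_closed by blast
  have h0: "h p = 0" if "p \<notin> K" for p
    using that f(2) by (auto simp: h_def)
  have deriv_in: "partial_deriv i h p = partial_deriv i f p * Y p + f p * partial_deriv i Y p"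
    if "p \<in> \<Omega>" for p
    using partial_deriv_cong_open[OF assms(1) that, of h "\<lambda>p. f p * Y p"]
      partial_deriv_mult[of f p Y i] f(1) Y that
    by (auto simp: h_def Ck_on_1)
  have deriv_off: "partial_deriv i h p = 0" if "p \<notin> K" for p
    using \<open>open (- K)\<close> h0 that by (intro partial_deriv_eq_0[of "- K"]) auto
  have "h differentiable (at p)" for p
  proof (cases "p \<in> \<Omega>")
    case True
    then have "((\<lambda>p. f p * Y p) has_derivative frechet_derivative (\<lambda>p. f p * Y p) (at p)) (at p)"
      using fY by (intro has_frechet_derivative) (auto simp: Ck_on_1)
    from has_derivative_transform_within_open[OF this assms(1) True, of h] show ?thesis
      by (auto simp: h_def differentiable_def)
  next
    case False
    then have "p \<in> - K"
      using assms(3) by blast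
    from has_derivative_transform_within_open[OF has_derivative_const \<open>open (- K)\<close> this, of 0 h]
    show ?thesis
      using h0 by (auto simp: differentiable_def)
  qed
  moreover have "continuous_on UNIV (partial_deriv i h)"
  proof -
    have "continuous_on \<Omega> (\<lambda>p. partial_deriv i f p * Y p + f p * partial_deriv i Y p)"
      using f(1) Y Ck_on_1_continuous unfolding Ck_on_1 by (intro continuous_intros) auto
    then have "continuous_on \<Omega> (partial_deriv i h)"
      by (simp add: deriv_in cong: continuous_on_cong_simp)
    moreover have "continuous_on (- K) (partial_deriv i h)"
      by (simp add: deriv_off cong: continuous_on_cong_simp)
    \<comment> \<open>The open sets \<open>\<Omega>\<close> and \<open>- K\<close> cover the space,
      and continuity is local.\<close>
    ultimately have "continuous_on (\<Omega> \<union> - K) (partial_deriv i h)"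
      using \<open>open \<Omega>\<close> \<open>open (- K)\<close> by (rule continuous_on_open_Un[rotated 2])
    moreover have "\<Omega> \<union> - K = UNIV"
      using assms(3) by blast
    ultimately show ?thesis by simp
  qed
  ultimately have "(LINT p|lborel. partial_deriv i h p) = 0"
    using assms(2) h0 by (intro integral_partial_deriv_eq_0)
  moreover have "partial_deriv i h p
      = indicator \<Omega> p *\<^sub>R (partial_deriv i f p * Y p + f p * partial_deriv i Y p)" for p
    using deriv_in[of p] deriv_off[of p] assms(3) by (cases "p \<in> \<Omega>") auto
  ultimately have "(LINT p:\<Omega>|lborel. partial_deriv i f p * Y p + f p * partial_deriv i Y p) = 0"
    by (simp add: set_lebesgue_integral_def)
  moreover have "set_integrable lborel \<Omega> (\<lambda>p. partial_deriv i f p * Y p)"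
  proof (rule set_integrable_compact_support[OF _ assms(2,3)])
    show "continuous_on \<Omega> (\<lambda>p. partial_deriv i f p * Y p)"
      using f(1) Ck_on_1_continuous[OF Y] by (intro continuous_on_mult) (auto simp: Ck_on_1)
    fix p assume "p \<in> \<Omega> - K"
    then have "partial_deriv i f p = 0"
      using assms(1,2) f(2) by (intro partial_deriv_eq_0[of "\<Omega> - K"])
        (auto intro: open_Diff compact_imp_closed)
    then show "partial_deriv i f p * Y p = 0" by simp
  qed
  moreover have "set_integrable lborel \<Omega> (\<lambda>p. f p * partial_deriv i Y p)"
  proof (rule set_integrable_compact_support[OF _ assms(2,3)])
    show "continuous_on \<Omega> (\<lambda>p. f p * partial_deriv i Y p)"
      using Ck_on_1_continuous[OF f(1)] Y by (intro continuous_on_mult) (auto simp: Ck_on_1)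
  qed (simp add: f(2))
  ultimately show ?thesis
    by (simp add: set_integral_add)
qed

section \<open>Truncations\<close>

text \<open>Only the junction \<open>a\<close> needs an argument: there the difference quotient of
  the truncation is bounded by that of \<open>f\<close>, which tends to
  \<open>f' a = 0\<close>.\<close>

lemma has_real_derivative_truncate:
  fixes f f' :: "real \<Rightarrow> real"
  assumes f: "\<And>x. a \<le> x \<Longrightarrow> (f has_real_derivative f' x) (at x)" and "f a = 0" "f' a = 0"
  shows "((\<lambda>x. if x \<le> a then 0 else f x) has_real_derivative (if x \<le> a then 0 else f' x)) (at x)"
    (is "(?g has_real_derivative _) _")
proof (rule linorder_cases[of x a])
  assume "x < a"
  then show ?thesis
    using has_field_derivative_transform_within_open[OF DERIV_const[of 0], where a = x and S = "{..<a}" and g = ?g] by auto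
next
  assume "a < x"
  then show ?thesis
    using has_field_derivative_transform_within_open[OF f[of x], where S = "{a<..}" and g = ?g] by auto
next
  assume [simp]: "x = a"
  have "(\<lambda>h. (f (a + h) - f a) / h) \<midarrow>0\<rightarrow> 0"
    using f[of a] assms(3) by (simp add: DERIV_def)
  moreover have "norm ((?g (a + h) - ?g a) / h) \<le> norm ((f (a + h) - f a) / h)" for h
  proof (cases "a + h \<le> a")
    case True
    then show ?thesis by (simp only: if_True order_refl diff_self div_0 norm_zero norm_ge_zero)
  next
    case False
    then show ?thesis by (simp add: assms(2))
  qed
  ultimately have "(\<lambda>h. (?g (a + h) - ?g a) / h) \<midarrow>0\<rightarrow> 0"
    by (rule Lim_null_comparison[OF always_eventually, rotated, OF tendsto_norm_zero, OF _ allI])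
  then show ?thesis
    by (simp add: DERIV_def)
qed

lemma continuous_on_truncate:
  fixes f :: "real \<Rightarrow> real"
  assumes "continuous_on {a..} f" "f a = 0"
  shows "continuous_on UNIV (\<lambda>x. if x \<le> a then 0 else f x)"
proof -
  have "continuous_on ({..a} \<union> {a..}) (\<lambda>x. if x \<le> a then 0 else f x)"
    using assms by (intro continuous_on_cases) auto
  moreover have "{..a} \<union> {a..} = UNIV"
    by auto
  ultimately show ?thesis by simp
qed

text \<open>A \<open>C\<^sup>1\<close> approximation of the identity on \<open>[0, \<infinity>)\<close> that vanishes near \<open>0\<close>.\<close>

definition cut :: "real \<Rightarrow> real \<Rightarrow> real" where
  "cut \<epsilon> x = (if x \<le> \<epsilon> then 0 else (x - \<epsilon>)\<^sup>2 / x)"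

text \<open>The derivative of \<open>cut \<epsilon>\<close>, since \<open>(x - \<epsilon>)\<^sup>2 /
  x = x - 2 * \<epsilon> + \<epsilon>\<^sup>2 / x\<close>. It vanishes at \<epsilon>, so the two
  pieces fit together, and its values in \<open>[0, 1]\<close> let it serve as a weight.\<close>

definition cut' :: "real \<Rightarrow> real \<Rightarrow> real" where
  "cut' \<epsilon> x = (if x \<le> \<epsilon> then 0 else 1 - (\<epsilon> / x)\<^sup>2)"

lemma cut_0: "\<bar>x\<bar> < \<epsilon> \<Longrightarrow> cut \<epsilon> x = 0"
  by (simp add: cut_def)

lemma has_real_derivative_cut:
  assumes "\<epsilon> > 0"
  shows "(cut \<epsilon> has_real_derivative cut' \<epsilon> x) (at x)"
proof -
  have "((\<lambda>x. (x - \<epsilon>)\<^sup>2 / x) has_real_derivative 1 - (\<epsilon> / x)\<^sup>2) (at x)" if "\<epsilon> \<le> x" for x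
    using assms that by (auto intro!: derivative_eq_intros simp: field_simps power2_eq_square)
  then show ?thesis
    unfolding cut_def[abs_def] cut'_def using assms by (intro has_real_derivative_truncate) auto
qed

lemma continuous_on_cut':
  assumes "\<epsilon> > 0"
  shows "continuous_on UNIV (cut' \<epsilon>)"
  unfolding cut'_def[abs_def] using assms
  by (intro continuous_on_truncate continuous_intros) auto

lemma cut'_bounds:
  assumes "\<epsilon> > 0"
  shows "0 \<le> cut' \<epsilon> x" "cut' \<epsilon> x \<le> 1"
  using assms by (auto simp: cut'_def power_le_one)

lemma cut_le:
  assumes "\<epsilon> > 0" "x \<ge> 0"
  shows "0 \<le> cut \<epsilon> x" "cut \<epsilon> x \<le> x"
proof -
  have "(x - \<epsilon>)\<^sup>2 \<le> x\<^sup>2" if "\<epsilon> < x"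
    using assms that by (intro power_mono) auto
  then show "cut \<epsilon> x \<le> x"
    using assms by (auto simp: cut_def power2_eq_square field_simps)
  show "0 \<le> cut \<epsilon> x"
    using assms by (auto simp: cut_def)
qed

lemma cut_tendsto:
  assumes "x \<ge> 0"
  shows "(\<lambda>n. cut (inverse (real (Suc n))) x) \<longlonglongrightarrow> x"
proof (cases "x = 0")
  case True
  then show ?thesis
    by (simp add: cut_def)
next
  case False
  have "(\<lambda>n. (x - inverse (real (Suc n)))\<^sup>2 / x) \<longlonglongrightarrow> (x - 0)\<^sup>2 / x"
    using False by (intro tendsto_intros LIMSEQ_inverse_real_of_nat) auto
  moreover have "\<forall>\<^sub>F n in sequentially. (x - inverse (real (Suc n)))\<^sup>2 / x = cut (inverse (real (Suc n))) x"
    using order_tendstoD(2)[OF LIMSEQ_inverse_real_of_nat, of x] assms False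
    by (auto elim!: eventually_mono simp: cut_def)
  ultimately show ?thesis
    using False by (simp add: power2_eq_square tendsto_cong)
qed

lemma cut'_tendsto:
  assumes "x > 0"
  shows "(\<lambda>n. cut' (inverse (real (Suc n))) x) \<longlonglongrightarrow> 1"
proof -
  have "(\<lambda>n. 1 - (inverse (real (Suc n)) / x)\<^sup>2) \<longlonglongrightarrow> 1 - (0 / x)\<^sup>2"
    using assms by (intro tendsto_intros LIMSEQ_inverse_real_of_nat) auto
  moreover have "\<forall>\<^sub>F n in sequentially. 1 - (inverse (real (Suc n)) / x)\<^sup>2 = cut' (inverse (real (Suc n))) x"
    using order_tendstoD(2)[OF LIMSEQ_inverse_real_of_nat, of x] assms
    by (auto elim!: eventually_mono simp: cut'_def)
  ultimately show ?thesis
    by (simp add: tendsto_cong)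
qed

section \<open>The Dirichlet problem\<close>

text \<open>The vector of chart derivatives, without the metric; \<open>gradient\<close> is the
  inverse Gram matrix applied to it.\<close>

definition grad :: "(real^'n::finite \<Rightarrow> real) \<Rightarrow> real^'n \<Rightarrow> real^'n" where
  "grad u p = (\<chi> i. partial_deriv i u p)"

lemma Ck_on_1_flux:
  fixes M :: "real^'n::finite \<Rightarrow> real^'n^'n"
  assumes "\<And>i j. Ck_on 1 \<Omega> (\<lambda>p. M p $ i $ j)" "Ck_on 2 \<Omega> u"
  shows "Ck_on 1 \<Omega> (\<lambda>p. (M p *v grad u p) $ i)"
proof -
  have "Ck_on 1 \<Omega> (\<lambda>p. \<Sum>j\<in>UNIV. M p $ i $ j * partial_deriv j u p)"
    using assms unfolding Ck_on_2 by (intro Ck_on_1_sum Ck_on_1_mult) auto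
  then show ?thesis
    by (simp add: matrix_vector_mult_def grad_def del: One_nat_def)
qed

text \<open>The torsion problem in divergence form, with Lebesgue measure. For the metrics below the
  volume density is constant and cancels from the Laplacian, and \<open>M\<close> is the inverse
  Gram matrix.\<close>

locale dirichlet_torsion =
  fixes \<Omega> :: "(real^'n::finite) set" and M :: "real^'n \<Rightarrow> real^'n^'n" and u :: "real^'n \<Rightarrow> real"
  assumes open_domain: "open \<Omega>" and compact_closure: "compact (closure \<Omega>)"
    and coeff: "\<And>i j. Ck_on 1 \<Omega> (\<lambda>p. M p $ i $ j)"
    and psd: "\<And>p x. p \<in> \<Omega> \<Longrightarrow> 0 \<le> x \<bullet> (M p *v x)"
    and C2: "Ck_on 2 \<Omega> u" and cont: "continuous_on (closure \<Omega>) u"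
    and boundary: "\<And>p. p \<in> frontier \<Omega> \<Longrightarrow> u p = 0"
    and equation: "\<And>p. p \<in> \<Omega> \<Longrightarrow> (\<Sum>i\<in>UNIV. partial_deriv i (\<lambda>q. (M q *v grad u q) $ i) p) = - 1"
begin

lemma C1: "Ck_on 1 \<Omega> u"
  using C2 by (rule Ck_on_2_imp_1)

lemma flux_C1: "Ck_on 1 \<Omega> (\<lambda>p. (M p *v grad u p) $ i)"
  using coeff C2 by (rule Ck_on_1_flux)

lemma continuous_grad: "continuous_on \<Omega> (grad u)"
  unfolding grad_def[abs_def] using C1 by (intro continuous_on_vec_lambda) (auto simp: Ck_on_1)

lemma continuous_flux: "continuous_on \<Omega> (\<lambda>p. M p *v grad u p)"
proof -
  have "continuous_on \<Omega> (\<lambda>p. \<chi> i. (M p *v grad u p) $ i)"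
    by (intro continuous_on_vec_lambda Ck_on_1_continuous flux_C1)
  then show ?thesis by simp
qed

lemma measurable_domain [measurable, simp]: "\<Omega> \<in> sets borel"
  using open_domain by auto

lemma integrable_solution: "set_integrable lborel \<Omega> u"
proof -
  have "set_integrable lborel (closure \<Omega>) u"
    unfolding set_integrable_def using compact_closure cont by (rule borel_integrable_compact)
  then show ?thesis
    by (rule set_integrable_subset) (auto simp: closure_subset)
qed

text \<open>Integration by parts in each coordinate moves the derivative from \<open>f\<close> to
  the flux, whose divergence is - 1. The compact support of \<open>f\<close> keeps the derivatives
  of \<open>u\<close> near the frontier out of play.\<close>

lemma weak_form:
  assumes "compact K" "K \<subseteq> \<Omega>" "Ck_on 1 \<Omega> f" "\<And>p. p \<in> \<Omega> - K \<Longrightarrow> f p = 0"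
  shows "(LINT p:\<Omega>|lborel. grad f p \<bullet> (M p *v grad u p)) = (LINT p:\<Omega>|lborel. f p)"
proof -
  let ?X = "\<lambda>i p. (M p *v grad u p) $ i"
  have f_cont: "continuous_on \<Omega> f"
    using assms(3) by (rule Ck_on_1_continuous)
  have int: "set_integrable lborel \<Omega> (\<lambda>p. partial_deriv i f p * ?X i p)" for i
  proof (rule set_integrable_compact_support[OF _ assms(1,2)])
    show "continuous_on \<Omega> (\<lambda>p. partial_deriv i f p * ?X i p)"
      using assms(3) Ck_on_1_continuous[OF flux_C1] by (intro continuous_on_mult) (auto simp: Ck_on_1)
    fix p assume "p \<in> \<Omega> - K"
    then have "partial_deriv i f p = 0"
      using assms open_domain by (intro partial_deriv_eq_0[of "\<Omega> - K"])
        (auto intro: open_Diff compact_imp_closed)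
    then show "partial_deriv i f p * ?X i p = 0" by simp
  qed
  have int': "set_integrable lborel \<Omega> (\<lambda>p. f p * partial_deriv i (?X i) p)" for i
    using assms f_cont flux_C1[of i]
    by (intro set_integrable_compact_support[OF _ assms(1,2)] continuous_on_mult) (auto simp: Ck_on_1)
  have "(LINT p:\<Omega>|lborel. grad f p \<bullet> (M p *v grad u p))
      = (LINT p:\<Omega>|lborel. \<Sum>i\<in>UNIV. partial_deriv i f p * ?X i p)"
    by (simp add: inner_vec_def grad_def)
  also have "\<dots> = (\<Sum>i\<in>UNIV. LINT p:\<Omega>|lborel. partial_deriv i f p * ?X i p)"
    unfolding set_lebesgue_integral_def scaleR_sum_right
    using int by (intro Bochner_Integration.integral_sum) (simp add: set_integrable_def)
  also have "\<dots> = (\<Sum>i\<in>UNIV. - (LINT p:\<Omega>|lborel. f p * partial_deriv i (?X i) p))"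
    using integral_by_parts_component[OF open_domain assms flux_C1] by simp
  also have "\<dots> = - (LINT p:\<Omega>|lborel. f p * (\<Sum>i\<in>UNIV. partial_deriv i (?X i) p))"
    unfolding set_lebesgue_integral_def scaleR_sum_right sum_negf sum_distrib_left
    using int' by (subst Bochner_Integration.integral_sum) (simp_all add: set_integrable_def)
  also have "\<dots> = - (LINT p:\<Omega>|lborel. f p * (- 1))"
    by (intro arg_cong[where f = uminus] set_lebesgue_integral_cong) (auto simp: equation)
  finally show ?thesis by (simp add: set_lebesgue_integral_def)
qed

text \<open>As \<open>u\<close> is 0 on the frontier, the set is closed in the compact closure of
  \<open>\<Omega>\<close>. It contains the supports of the truncations below.\<close>

lemma compact_superlevel:
  assumes "\<epsilon> > 0"
  shows "compact {p \<in> \<Omega>. \<epsilon> \<le> \<bar>u p\<bar>}"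
proof -
  have "p \<in> \<Omega>" if "p \<in> closure \<Omega>" "\<epsilon> \<le> \<bar>u p\<bar>" for p
    using that assms boundary[of p] open_domain by (cases "p \<in> \<Omega>") (auto simp: frontier_def interior_open)
  then have "{p \<in> \<Omega>. \<epsilon> \<le> \<bar>u p\<bar>} = closure \<Omega> \<inter> (closure \<Omega> \<inter> (\<lambda>p. \<bar>u p\<bar>) -` {\<epsilon>..})"
    using closure_subset[of \<Omega>] by auto
  moreover have "closed (closure \<Omega> \<inter> (\<lambda>p. \<bar>u p\<bar>) -` {\<epsilon>..})"
    using cont by (intro continuous_closed_preimage continuous_intros) auto
  ultimately show ?thesis
    using compact_closure compact_Int_closed by metis
qed

text \<open>Since \<open>\<phi>\<close> vanishes near 0, the function \<open>\<phi> (u p)\<close> is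
  supported in a compact superlevel set of \<open>u\<close> and is admissible in the weak
  form.\<close>

context
  fixes \<phi> \<phi>' :: "real \<Rightarrow> real" and \<epsilon> :: real
  assumes \<phi>: "\<And>x. (\<phi> has_real_derivative \<phi>' x) (at x)" and \<phi>'_cont: "continuous_on UNIV \<phi>'"
    and \<epsilon>: "\<epsilon> > 0" and \<phi>_0: "\<And>x. \<bar>x\<bar> < \<epsilon> \<Longrightarrow> \<phi> x = 0"
begin

lemma truncation_deriv_0: "\<phi>' x = 0" if "\<bar>x\<bar> < \<epsilon>"
proof -
  have "(\<phi> has_real_derivative 0) (at x)"
    using has_field_derivative_transform_within_open[OF DERIV_const[of 0], where a = x and S = "{- \<epsilon><..<\<epsilon>}" and g = \<phi>] \<phi>_0 that
    by (auto simp: abs_less_iff)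
  then show ?thesis
    using \<phi> DERIV_unique by blast
qed

lemma truncation_C1: "Ck_on 1 \<Omega> (\<lambda>p. \<phi> (u p))"
  using C1 \<phi> \<phi>'_cont by (rule Ck_on_1_compose)

lemma grad_truncation: "p \<in> \<Omega> \<Longrightarrow> grad (\<lambda>p. \<phi> (u p)) p = \<phi>' (u p) *\<^sub>R grad u p"
  using C1 \<phi> by (simp add: grad_def vec_eq_iff Ck_on_1 partial_deriv_compose)

lemma continuous_truncation: "continuous_on \<Omega> (\<lambda>p. \<phi>' (u p))"
  using \<phi>'_cont Ck_on_1_continuous[OF C1] by (rule continuous_on_compose2) auto

lemma integrable_truncation:
  "continuous_on \<Omega> k \<Longrightarrow> set_integrable lborel \<Omega> (\<lambda>p. \<phi>' (u p) * k p)"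
  using compact_superlevel[OF \<epsilon>] truncation_deriv_0 continuous_truncation
  by (intro set_integrable_compact_support[of _ _ "{p \<in> \<Omega>. \<epsilon> \<le> \<bar>u p\<bar>}"] continuous_on_mult) auto

lemma integrable_truncation': "set_integrable lborel \<Omega> (\<lambda>p. \<phi> (u p))"
  using compact_superlevel[OF \<epsilon>] \<phi>_0 Ck_on_1_continuous[OF truncation_C1]
  by (intro set_integrable_compact_support[of _ _ "{p \<in> \<Omega>. \<epsilon> \<le> \<bar>u p\<bar>}"]) auto

end

text \<open>The weak form is tested with a truncation of the negative part of \<open>u\<close>.\<close>

lemma nonneg:
  assumes "p \<in> \<Omega>"
  shows "0 \<le> u p"
proof (rule ccontr)
  assume "\<not> 0 \<le> u p"
  \<comment> \<open>Half the depth at \<open>p\<close>, so that \<open>u p < - \<epsilon>\<close> is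
    strict.\<close>
  define \<epsilon> where "\<epsilon> = - u p / 2"
  have \<epsilon>: "\<epsilon> > 0" "u p < - \<epsilon>"
    using \<open>\<not> 0 \<le> u p\<close> by (auto simp: \<epsilon>_def)
  \<comment> \<open>Minus the squared excess of \<open>- x\<close> over \<epsilon>: nonpositive but
    nondecreasing, which forces both signs on the integral of \<open>\<phi> (u q)\<close>.\<close>
  define \<phi> where "\<phi> x = - (if - x \<le> \<epsilon> then 0 else (- x - \<epsilon>)\<^sup>2)" for x
  define \<phi>' where "\<phi>' x = (if - x \<le> \<epsilon> then 0 else 2 * (- x - \<epsilon>))" for x
  have \<phi>: "(\<phi> has_real_derivative \<phi>' x) (at x)" for x
  proof -
    have "((\<lambda>x. if x \<le> \<epsilon> then 0 else (x - \<epsilon>)\<^sup>2) has_real_derivative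
        (if x \<le> \<epsilon> then 0 else 2 * (x - \<epsilon>))) (at x)" for x
      by (rule has_real_derivative_truncate) (auto intro!: derivative_eq_intros)
    from DERIV_minus[OF DERIV_chain2[OF this DERIV_minus[OF DERIV_ident]], of x] show ?thesis
      unfolding \<phi>_def[abs_def] \<phi>'_def by simp
  qed
  have "continuous_on UNIV (\<lambda>x. if x \<le> \<epsilon> then 0 else 2 * (x - \<epsilon>))"
    by (intro continuous_on_truncate continuous_intros) auto
  then have \<phi>'_cont: "continuous_on UNIV \<phi>'"
    unfolding \<phi>'_def[abs_def] by (rule continuous_on_compose2) (auto intro!: continuous_intros)
  have \<phi>_0: "\<phi> x = 0" if "\<bar>x\<bar> < \<epsilon>" for x
    using that by (auto simp: \<phi>_def)
  note trunc = \<phi> \<phi>'_cont \<epsilon>(1) \<phi>_0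
  have \<phi>_le: "\<phi> x \<le> 0" and \<phi>'_ge: "0 \<le> \<phi>' x" for x
    by (auto simp: \<phi>_def \<phi>'_def)
  have "(LINT q:\<Omega>|lborel. \<phi> (u q)) = (LINT q:\<Omega>|lborel. grad (\<lambda>q. \<phi> (u q)) q \<bullet> (M q *v grad u q))"
    using \<phi>_0 by (intro weak_form[symmetric, OF compact_superlevel[OF \<epsilon>(1)]] truncation_C1[OF trunc]) auto
  also have "\<dots> \<ge> 0"
    using psd \<phi>'_ge unfolding set_lebesgue_integral_def
    by (intro Bochner_Integration.integral_nonneg) (auto simp: indicator_def grad_truncation[OF trunc])
  finally have "(LINT q:\<Omega>|lborel. - \<phi> (u q)) \<le> 0"
    by (simp add: set_lebesgue_integral_def)
  moreover have "(LINT q:\<Omega>|lborel. - \<phi> (u q)) \<ge> 0"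
    using \<phi>_le unfolding set_lebesgue_integral_def
    by (intro Bochner_Integration.integral_nonneg) (auto intro: mult_nonneg_nonpos)
  ultimately have "(LINT q|lborel. indicator \<Omega> q *\<^sub>R (- \<phi> (u q))) = 0"
    by (simp add: set_lebesgue_integral_def)
  moreover have "integrable lborel (\<lambda>q. indicator \<Omega> q *\<^sub>R (- \<phi> (u q)))"
    using integrable_truncation'[OF trunc] by (simp add: set_integrable_def)
  ultimately have "AE q in lborel. indicator \<Omega> q *\<^sub>R (- \<phi> (u q)) = 0"
    using \<phi>_le by (subst (asm) integral_nonneg_eq_0_iff_AE) (auto intro!: AE_I2 mult_nonneg_nonpos)
  \<comment> \<open>The set where \<open>u < - \<epsilon>\<close> is null and open, hence empty; but
    it contains \<open>p\<close>.\<close>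
  then have "AE q in lborel. q \<notin> {q \<in> \<Omega>. u q < - \<epsilon>}"
    by (elim AE_mp) (auto simp: \<phi>_def intro!: AE_I2)
  moreover have "open {q \<in> \<Omega>. u q < - \<epsilon>}"
  proof -
    have "open (\<Omega> \<inter> u -` {..<- \<epsilon>})"
      using Ck_on_1_continuous[OF C1] open_domain by (intro continuous_open_preimage) auto
    moreover have "\<Omega> \<inter> u -` {..<- \<epsilon>} = {q \<in> \<Omega>. u q < - \<epsilon>}"
      by auto
    ultimately show ?thesis by simp
  qed
  ultimately have "p \<in> - {q \<in> \<Omega>. u q < - \<epsilon>}"
    by (intro mem_closed_if_AE_lebesgue AE_completion) auto
  then show False
    using assms \<epsilon>(2) by auto
qed

text \<open>A zero of the nonnegative \<open>u\<close> is an interior minimum. Strict positivity of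
  \<open>u\<close> is not established, so the limit in \<open>energy_le\<close> has to cover such
  points.\<close>

lemma grad_eq_0:
  assumes "p \<in> \<Omega>" "u p = 0"
  shows "grad u p = 0"
proof -
  have "(u has_derivative frechet_derivative u (at p)) (at p)"
    using C1 assms(1) by (intro has_frechet_derivative) (simp add: Ck_on_1)
  moreover have "\<forall>\<^sub>F q in at p. u p \<le> u q"
    using eventually_at_topological open_domain assms nonneg by (metis (full_types))
  ultimately have "frechet_derivative u (at p) = (\<lambda>h. 0)"
    by (rule has_derivative_local_min)
  then show ?thesis
    by (simp add: grad_def partial_deriv_def vec_eq_iff)
qed

section \<open>The energy of the solution\<close>

lemma continuous_energy: "continuous_on \<Omega> (\<lambda>p. grad u p \<bullet> (M p *v grad u p))"
  using continuous_grad continuous_flux by (rule continuous_on_inner)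

text \<open>The weak form, tested with a truncation of the solution itself.\<close>

lemma cut_energy:
  assumes "\<epsilon> > 0"
  shows "(LINT p:\<Omega>|lborel. cut' \<epsilon> (u p) * (grad u p \<bullet> (M p *v grad u p))) = (LINT p:\<Omega>|lborel. cut \<epsilon> (u p))"
proof -
  note trunc = has_real_derivative_cut[OF assms] continuous_on_cut'[OF assms] assms cut_0
  have "(LINT p:\<Omega>|lborel. cut \<epsilon> (u p)) = (LINT p:\<Omega>|lborel. grad (\<lambda>p. cut \<epsilon> (u p)) p \<bullet> (M p *v grad u p))"
    using cut_0
    by (intro weak_form[symmetric, OF compact_superlevel[OF assms]] truncation_C1[OF trunc]) auto
  also have "\<dots> = (LINT p:\<Omega>|lborel. cut' \<epsilon> (u p) * (grad u p \<bullet> (M p *v grad u p)))"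
    by (intro set_lebesgue_integral_cong) (auto simp: grad_truncation[OF trunc])
  finally show ?thesis ..
qed

text \<open>Integrability of the energy density up to the frontier is not known, hence the compactly
  supported weight \<open>\<kappa>\<close>. With the additional weight
  \<open>cut' (d n) (u p)\<close> the integral is at most that of \<open>cut (d n) (u p)\<close>, by
  \<open>\<kappa> \<le> 1\<close> and \<open>cut_energy\<close>, and so at most that of
  \<open>u\<close>; then \<open>n\<close> tends to infinity.\<close>

lemma energy_le:
  assumes "compact K" "K \<subseteq> \<Omega>" "continuous_on \<Omega> \<kappa>" "\<And>p. p \<in> \<Omega> - K \<Longrightarrow> \<kappa> p = 0"
    and \<kappa>: "\<And>p. p \<in> \<Omega> \<Longrightarrow> 0 \<le> \<kappa> p" "\<And>p. p \<in> \<Omega> \<Longrightarrow> \<kappa> p \<le> 1"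
  shows "(LINT p:\<Omega>|lborel. \<kappa> p * (grad u p \<bullet> (M p *v grad u p))) \<le> (LINT p:\<Omega>|lborel. u p)"
proof -
  let ?e = "\<lambda>p. grad u p \<bullet> (M p *v grad u p)"
  define d where "d n = inverse (real (Suc n))" for n
  have d: "d n > 0" for n
    by (simp add: d_def)
  have trunc: "\<And>x. (cut (d n) has_real_derivative cut' (d n) x) (at x)" "continuous_on UNIV (cut' (d n))"
    "d n > 0" "\<And>x. \<bar>x\<bar> < d n \<Longrightarrow> cut (d n) x = 0" for n
    using has_real_derivative_cut[OF d] continuous_on_cut'[OF d] d cut_0 by auto
  have int: "set_integrable lborel \<Omega> (\<lambda>p. \<kappa> p * ?e p)"
    using assms continuous_energy
    by (intro set_integrable_compact_support[OF _ assms(1,2)] continuous_on_mult) auto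
  have int_n: "set_integrable lborel \<Omega> (\<lambda>p. cut' (d n) (u p) * (\<kappa> p * ?e p))" for n
    using assms continuous_energy
    by (intro integrable_truncation[OF trunc] continuous_on_mult) auto
  have "(\<lambda>n. LINT p:\<Omega>|lborel. cut' (d n) (u p) * (\<kappa> p * ?e p)) \<longlonglongrightarrow> (LINT p:\<Omega>|lborel. \<kappa> p * ?e p)"
    unfolding set_lebesgue_integral_def
  proof (rule integral_dominated_convergence)
    show "(\<lambda>p. indicator \<Omega> p *\<^sub>R (\<kappa> p * ?e p)) \<in> borel_measurable lborel"
      using int unfolding set_integrable_def by (rule borel_measurable_integrable)
    show "(\<lambda>p. indicator \<Omega> p *\<^sub>R (cut' (d n) (u p) * (\<kappa> p * ?e p))) \<in> borel_measurable lborel" for n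
      using int_n[of n] unfolding set_integrable_def by (rule borel_measurable_integrable)
    show "integrable lborel (\<lambda>p. indicator \<Omega> p *\<^sub>R (\<kappa> p * ?e p))"
      using int unfolding set_integrable_def .
    show "AE p in lborel. (\<lambda>n. indicator \<Omega> p *\<^sub>R (cut' (d n) (u p) * (\<kappa> p * ?e p)))
        \<longlonglongrightarrow> indicator \<Omega> p *\<^sub>R (\<kappa> p * ?e p)"
    proof (rule AE_I2)
      fix p
      \<comment> \<open>Zeros of \<open>u\<close> are minima, so the energy density vanishes there.\<close>
      consider "p \<notin> \<Omega>" | "p \<in> \<Omega>" "u p = 0" | "p \<in> \<Omega>" "u p > 0"
        using nonneg[of p] by fastforce
      then show "(\<lambda>n. indicator \<Omega> p *\<^sub>R (cut' (d n) (u p) * (\<kappa> p * ?e p)))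
          \<longlonglongrightarrow> indicator \<Omega> p *\<^sub>R (\<kappa> p * ?e p)"
      proof cases
        case 3
        have "(\<lambda>n. indicator \<Omega> p *\<^sub>R (cut' (d n) (u p) * (\<kappa> p * ?e p)))
            \<longlonglongrightarrow> indicator \<Omega> p *\<^sub>R (1 * (\<kappa> p * ?e p))"
          unfolding d_def by (intro tendsto_intros cut'_tendsto 3)
        then show ?thesis by simp
      qed (auto simp: grad_eq_0)
    qed
    show "AE p in lborel. norm (indicator \<Omega> p *\<^sub>R (cut' (d n) (u p) * (\<kappa> p * ?e p)))
        \<le> indicator \<Omega> p *\<^sub>R (\<kappa> p * ?e p)" for n
      using cut'_bounds[OF d] \<kappa> psd
      by (intro AE_I2) (auto simp: indicator_def abs_mult intro!: mult_left_le_one_le)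
  qed
  moreover have "(LINT p:\<Omega>|lborel. cut' (d n) (u p) * (\<kappa> p * ?e p)) \<le> (LINT p:\<Omega>|lborel. u p)" for n
  proof -
    have "(LINT p:\<Omega>|lborel. cut' (d n) (u p) * (\<kappa> p * ?e p)) \<le> (LINT p:\<Omega>|lborel. cut' (d n) (u p) * ?e p)"
      using int_n integrable_truncation[OF trunc continuous_energy] cut'_bounds[OF d] \<kappa> psd
      by (intro set_integral_mono) (auto intro!: mult_left_mono mult_left_le_one_le)
    also have "\<dots> = (LINT p:\<Omega>|lborel. cut (d n) (u p))"
      by (rule cut_energy[OF d])
    also have "\<dots> \<le> (LINT p:\<Omega>|lborel. u p)"
      using integrable_truncation'[OF trunc] integrable_solution cut_le[OF d] nonneg
      by (intro set_integral_mono) auto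
    finally show ?thesis .
  qed
  ultimately show ?thesis
    by (intro LIMSEQ_le_const2) auto
qed

end

section \<open>Comparison of two Dirichlet problems\<close>

theorem torsion_comparison:
  assumes u: "dirichlet_torsion \<Omega> M u" and v: "dirichlet_torsion \<Omega> N v"
    and sym: "\<And>p. p \<in> \<Omega> \<Longrightarrow> transpose (M p) = M p"
    and "m > 0" and le: "\<And>p x. p \<in> \<Omega> \<Longrightarrow> m * (x \<bullet> (M p *v x)) \<le> x \<bullet> (N p *v x)"
  shows "(LINT p:\<Omega>|lborel. v p) \<le> (LINT p:\<Omega>|lborel. u p) / m"
proof -
  interpret u: dirichlet_torsion \<Omega> M u by (rule u)
  interpret v: dirichlet_torsion \<Omega> N v by (rule v)
  \<comment> \<open>The claim for the truncation of \<open>v\<close> at level \<epsilon>; at the end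
    \<epsilon> tends to 0.\<close>
  have bound: "(LINT p:\<Omega>|lborel. cut \<epsilon> (v p)) \<le> (LINT p:\<Omega>|lborel. u p) / m" if "\<epsilon> > 0" for \<epsilon>
  proof -
    let ?\<kappa> = "\<lambda>p. cut' \<epsilon> (v p)"
    let ?K = "{p \<in> \<Omega>. \<epsilon> \<le> \<bar>v p\<bar>}"
    let ?I = "LINT p:\<Omega>|lborel. cut \<epsilon> (v p)"
    let ?eu = "\<lambda>p. grad u p \<bullet> (M p *v grad u p)" and ?ev = "\<lambda>p. grad v p \<bullet> (N p *v grad v p)"
    let ?uv = "\<lambda>p. grad v p \<bullet> (M p *v grad u p)"
    note trunc = has_real_derivative_cut[OF that] continuous_on_cut'[OF that] that cut_0
    have uv_int: "set_integrable lborel \<Omega> (\<lambda>p. ?\<kappa> p * ?uv p)"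
      using v.continuous_grad u.continuous_flux
      by (intro v.integrable_truncation[OF trunc] continuous_on_inner)
    have u_int: "set_integrable lborel \<Omega> (\<lambda>p. ?\<kappa> p * ?eu p)"
      by (intro v.integrable_truncation[OF trunc] u.continuous_energy)
    have v_int: "set_integrable lborel \<Omega> (\<lambda>p. ?\<kappa> p * ?ev p)"
      by (intro v.integrable_truncation[OF trunc] v.continuous_energy)
    \<comment> \<open>The equation of \<open>u\<close> is tested with the truncation of
      \<open>v\<close>.\<close>
    have "?I = (LINT p:\<Omega>|lborel. grad (\<lambda>p. cut \<epsilon> (v p)) p \<bullet> (M p *v grad u p))"
      using cut_0
      by (intro u.weak_form[symmetric, OF v.compact_superlevel[OF that]] v.truncation_C1[OF trunc]) auto
    also have "\<dots> = (LINT p:\<Omega>|lborel. ?\<kappa> p * ?uv p)"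
      by (intro set_lebesgue_integral_cong) (auto simp: v.grad_truncation[OF trunc])
    finally have I: "?I = (LINT p:\<Omega>|lborel. ?\<kappa> p * ?uv p)" .
    have "2 * ?I = (LINT p:\<Omega>|lborel. 2 * (?\<kappa> p * ?uv p))"
      by (simp add: I)
    also have "\<dots> \<le> (LINT p:\<Omega>|lborel. ?\<kappa> p * ?ev p + ?\<kappa> p * ?eu p / m)"
    proof (rule set_integral_mono)
      show "set_integrable lborel \<Omega> (\<lambda>p. 2 * (?\<kappa> p * ?uv p))"
        using uv_int by simp
      show "set_integrable lborel \<Omega> (\<lambda>p. ?\<kappa> p * ?ev p + ?\<kappa> p * ?eu p / m)"
        using v_int u_int by (intro set_integral_add) auto
      fix p assume p: "p \<in> \<Omega>"
      let ?x = "grad v p" and ?y = "grad u p"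
      have comm: "?y \<bullet> (M p *v ?x) = ?x \<bullet> (M p *v ?y)"
        using dot_lmul_matrix[of ?y "M p" ?x] sym[OF p]
        by (metis inner_commute transpose_matrix_vector)
      \<comment> \<open>Young's inequality with weight \<open>m\<close>: the semidefinite form is
        expanded at \<open>m x - y\<close> and divided by \<open>m\<close>. Symmetry of
        \<open>M p\<close> merges the two mixed terms.\<close>
      have "0 \<le> (m *\<^sub>R ?x - ?y) \<bullet> (M p *v (m *\<^sub>R ?x - ?y))"
        using u.psd p by blast
      also have "\<dots> = m * (m * (?x \<bullet> (M p *v ?x))) - m * (2 * (?x \<bullet> (M p *v ?y))) + ?y \<bullet> (M p *v ?y)"
        by (simp add: matrix_vector_mult_diff_distrib scaleR_matrix_vector_assoc[symmetric]
            matrix_vector_mult_scaleR inner_diff_left inner_diff_right comm algebra_simps)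
      finally have "2 * (?x \<bullet> (M p *v ?y)) \<le> m * (?x \<bullet> (M p *v ?x)) + (?y \<bullet> (M p *v ?y)) / m"
        using \<open>m > 0\<close> by (simp add: field_simps)
      also have "\<dots> \<le> ?ev p + ?eu p / m"
        using le[OF p] by simp
      finally have "?\<kappa> p * (2 * ?uv p) \<le> ?\<kappa> p * (?ev p + ?eu p / m)"
        using cut'_bounds[OF that] by (intro mult_left_mono)
      then show "2 * (?\<kappa> p * ?uv p) \<le> ?\<kappa> p * ?ev p + ?\<kappa> p * ?eu p / m"
        by (simp add: algebra_simps)
    qed
    \<comment> \<open>By \<open>cut_energy\<close> the weighted energy of \<open>v\<close> is
      \<open>?I\<close> again and is absorbed by \<open>2 * ?I\<close>. The energy of
      \<open>u\<close> carries a weight built from \<open>v\<close>, which is why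
      \<open>energy_le\<close> allows a general \<open>\<kappa>\<close>.\<close>
    also have "\<dots> = ?I + (LINT p:\<Omega>|lborel. ?\<kappa> p * ?eu p) / m"
      using v_int u_int by (simp add: set_integral_add v.cut_energy[OF that])
    also have "(LINT p:\<Omega>|lborel. ?\<kappa> p * ?eu p) \<le> (LINT p:\<Omega>|lborel. u p)"
      using v.compact_superlevel[OF that] v.continuous_truncation[OF trunc] cut'_bounds[OF that]
        v.truncation_deriv_0[OF trunc]
      by (intro u.energy_le[of ?K]) auto
    finally show ?thesis
      using \<open>m > 0\<close> by (simp add: divide_right_mono)
  qed
  \<comment> \<open>Dominated convergence with bound \<open>v\<close>, as
    \<open>0 \<le> cut \<epsilon> x \<le> x\<close> for nonnegative \<open>x\<close>.\<close>
  have "(\<lambda>n. LINT p:\<Omega>|lborel. cut (inverse (real (Suc n))) (v p)) \<longlonglongrightarrow> (LINT p:\<Omega>|lborel. v p)"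
    unfolding set_lebesgue_integral_def
  proof (rule integral_dominated_convergence)
    show "integrable lborel (\<lambda>p. indicator \<Omega> p *\<^sub>R v p)"
      using v.integrable_solution unfolding set_integrable_def .
    then show "(\<lambda>p. indicator \<Omega> p *\<^sub>R v p) \<in> borel_measurable lborel"
      by (rule borel_measurable_integrable)
    show "(\<lambda>p. indicator \<Omega> p *\<^sub>R cut (inverse (real (Suc n))) (v p)) \<in> borel_measurable lborel" for n
    proof -
      have "inverse (real (Suc n)) > 0" by simp
      from v.integrable_truncation'[OF has_real_derivative_cut[OF this] continuous_on_cut'[OF this] this cut_0]
      show ?thesis
        unfolding set_integrable_def by (rule borel_measurable_integrable)
    qed
    show "AE p in lborel. (\<lambda>n. indicator \<Omega> p *\<^sub>R cut (inverse (real (Suc n))) (v p))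
        \<longlonglongrightarrow> indicator \<Omega> p *\<^sub>R v p"
      using cut_tendsto v.nonneg by (intro AE_I2) (auto simp: indicator_def)
    show "AE p in lborel. norm (indicator \<Omega> p *\<^sub>R cut (inverse (real (Suc n))) (v p))
        \<le> indicator \<Omega> p *\<^sub>R v p" for n
      using cut_le v.nonneg by (intro AE_I2) (auto simp: indicator_def)
  qed
  then show ?thesis
    using bound by (intro LIMSEQ_le_const2) auto
qed

section \<open>Ricci curvature of a left invariant metric\<close>

lemma partial_deriv_function_of_coord:
  fixes f :: "real \<Rightarrow> real" and p :: "real^'n::finite"
  assumes "(f has_real_derivative f') (at (p$k))"
  shows "partial_deriv i (\<lambda>q. f (q$k)) p = (if i = k then f' else 0)"
proof -
  have "((\<lambda>q::real^'n. q$k) has_derivative (\<lambda>h. h$k)) (at p)"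
    by (intro bounded_linear_imp_has_derivative bounded_linear_vec_nth)
  then have "((\<lambda>q. f (q$k)) has_derivative (\<lambda>h. f' * h$k)) (at p)"
    using has_derivative_compose[of "\<lambda>q::real^'n. q$k" "\<lambda>h. h$k" p UNIV f "times f'"] assms
    by (simp add: has_field_derivative_def)
  then show ?thesis
    by (simp add: partial_deriv_def frechet_derivative_at[symmetric] axis_def)
qed

text \<open>\<open>matrix_inv\<close> is chosen among the two-sided inverses; a right inverse of a
  square matrix is one of them, and it is unique.\<close>

lemma matrix_inv_eqI:
  fixes M :: "real^'n^'n"
  assumes "M ** N = mat 1"
  shows "matrix_inv M = N"
proof -
  have "N ** M = mat 1"
    using assms matrix_left_right_inverse by blast
  then have "\<exists>N. M ** N = mat 1 \<and> N ** M = mat 1"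
    using assms by blast
  then have "matrix_inv M ** M = mat 1"
    unfolding matrix_inv_def by (rule someI2_ex) blast
  then have "matrix_inv M ** (M ** N) = N"
    by (simp add: matrix_mul_assoc)
  then show ?thesis by (simp add: assms)
qed

text \<open>The metric \<open>c (dz + a dx - (x - b) dy)\<^sup>2 + P dx\<^sup>2 + 2 Q dx dy + R dy\<^sup>2\<close> in the coordinates
  \<open>(x, y, z)\<close> of the global chart.\<close>

locale heisenberg_metric =
  fixes g :: "3 form2" and a b c P Q R :: real
  assumes c: "c \<noteq> 0" and det: "P * R - Q\<^sup>2 \<noteq> 0"
    and gram: "\<And>p. gram g p =
      vector [vector [P + c * a\<^sup>2, Q - c * a * (p$1 - b), c * a],
              vector [Q - c * a * (p$1 - b), R + c * (p$1 - b)\<^sup>2, - c * (p$1 - b)],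
              vector [c * a, - c * (p$1 - b), c]]"
begin

text \<open>The reciprocal determinant of the base form
  \<open>P dx\<^sup>2 + 2 Q dx dy + R dy\<^sup>2\<close>, named so that it can be carried through
  the computations as an indeterminate.\<close>

definition "K = 1 / (P * R - Q\<^sup>2)"

lemma K: "K * (P * R - Q\<^sup>2) = 1"
  using det by (simp add: K_def)

text \<open>The fields \<open>\<partial>x - a \<partial>z\<close> and
  \<open>\<partial>y + u \<partial>z\<close> span the kernel of \<open>dz + a dx - u dy\<close>. The
  inverse metric is the inverse base form on these two, plus \<open>1 / c\<close> times the square
  of \<open>\<partial>z\<close>.\<close>

lemma gram_inv:
  "gram_inv g p = (let u = p$1 - b in
     vector [vector [K * R, - K * Q, - K * (a * R + u * Q)],
             vector [- K * Q, K * P, K * (a * Q + u * P)],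
             vector [- K * (a * R + u * Q), K * (a * Q + u * P),
                     K * (R * a\<^sup>2 + 2 * Q * a * u + P * u\<^sup>2) + 1 / c]])" (is "_ = ?H")
proof -
  have "gram g p ** ?H = mat 1"
    unfolding gram vec_eq_iff forall_3 matrix_matrix_mult_def sum_3 mat_def Let_def
    using K c by (simp; intro conjI; simp add: field_simps power2_eq_square; algebra)
  then show ?thesis
    unfolding gram_inv_def by (rule matrix_inv_eqI)
qed

lemma det_gram: "det (gram g p) = c * (P * R - Q\<^sup>2)"
  by (simp add: det_3 gram power2_eq_square algebra_simps)

lemma partial_deriv_gram:
  "partial_deriv i (\<lambda>q. gram g q $ j $ k) p =
    (if i = 1 then
      vector [vector [0, - c * a, 0], vector [- c * a, 2 * c * (p$1 - b), - c], vector [0, - c, 0]] $ j $ k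
     else 0)"
proof -
  have "((\<lambda>x. Q - c * a * (x - b)) has_real_derivative - c * a) (at (p$1))"
    by (auto intro!: derivative_eq_intros)
  note d1 = partial_deriv_function_of_coord[OF this, where i=i]
  have "((\<lambda>x. R + c * (x - b)\<^sup>2) has_real_derivative 2 * c * (p$1 - b)) (at (p$1))"
    by (auto intro!: derivative_eq_intros)
  note d2 = partial_deriv_function_of_coord[OF this, where i=i]
  have "((\<lambda>x. - c * (x - b)) has_real_derivative - c) (at (p$1))"
    by (auto intro!: derivative_eq_intros)
  note d3 = partial_deriv_function_of_coord[OF this, where i=i]
  have "((\<lambda>x. d) has_real_derivative 0) (at (p$1))" for d
    by (auto intro!: derivative_eq_intros)
  note d4 = partial_deriv_function_of_coord[OF this, where i=i]
  show ?thesis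
    using exhaust_3[of j] exhaust_3[of k] d1 d2 d3 d4 by (elim disjE) (simp_all add: gram)
qed

text \<open>The Christoffel symbol \<open>\<Gamma>\<^sup>k\<^sub>i\<^sub>j\<close> is a quadratic polynomial in \<open>x - b\<close>, whose coefficients are the
  entries \<open>$ i $ j $ k\<close> of the following arrays.\<close>

definition "\<Gamma>\<^sub>0 = (vector [
         vector [vector [c * K * a * Q, - c * K * a * P, - c * K * a\<^sup>2 * Q],
                  vector [c * K / 2 * a * R, - c * K / 2 * a * Q, - c * K / 2 * R * a\<^sup>2 - 1 / 2],
                  vector [c * K / 2 * Q, - c * K / 2 * P, - c * K / 2 * a * Q] :: real^3],
         vector [vector [c * K / 2 * a * R, - c * K / 2 * a * Q, - c * K / 2 * R * a\<^sup>2 - 1 / 2],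
                  vector [0, 0, 0],
                  vector [c * K / 2 * R, - c * K / 2 * Q, - c * K / 2 * a * R] :: real^3],
         vector [vector [c * K / 2 * Q, - c * K / 2 * P, - c * K / 2 * a * Q],
                  vector [c * K / 2 * R, - c * K / 2 * Q, - c * K / 2 * a * R],
                  vector [0, 0, 0] :: real^3]] :: real^3^3^3)"

definition "\<Gamma>\<^sub>1 = (vector [
         vector [vector [0, 0, - c * K * a * P],
                  vector [- c * K / 2 * Q, c * K / 2 * P, 0],
                  vector [0, 0, - c * K / 2 * P] :: real^3],
         vector [vector [- c * K / 2 * Q, c * K / 2 * P, 0],
                  vector [- c * K * R, c * K * Q, c * K * a * R],
                  vector [0, 0, - c * K / 2 * Q] :: real^3],
         vector [vector [0, 0, - c * K / 2 * P],
                  vector [0, 0, - c * K / 2 * Q],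
                  vector [0, 0, 0] :: real^3]] :: real^3^3^3)"

definition "\<Gamma>\<^sub>2 = (vector [
         vector [vector [0, 0, 0],
                  vector [0, 0, c * K / 2 * P],
                  vector [0, 0, 0] :: real^3],
         vector [vector [0, 0, c * K / 2 * P],
                  vector [0, 0, c * K * Q],
                  vector [0, 0, 0] :: real^3],
         vector [vector [0, 0, 0],
                  vector [0, 0, 0],
                  vector [0, 0, 0] :: real^3]] :: real^3^3^3)"

lemma christoffel:
  "christoffel g k i j p =
    \<Gamma>\<^sub>0$i$j$k + \<Gamma>\<^sub>1$i$j$k * (p$1 - b) + \<Gamma>\<^sub>2$i$j$k * (p$1 - b)\<^sup>2"
  using exhaust_3[of i] exhaust_3[of j] exhaust_3[of k] c
  unfolding christoffel_def partial_deriv_gram sum_3 gram_inv Let_def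
    \<Gamma>\<^sub>0_def \<Gamma>\<^sub>1_def \<Gamma>\<^sub>2_def
  by (elim disjE) (simp_all add: field_simps power2_eq_square)

lemma partial_deriv_christoffel:
  "partial_deriv l (christoffel g k i j) p =
    (if l = 1 then \<Gamma>\<^sub>1$i$j$k + 2 * \<Gamma>\<^sub>2$i$j$k * (p$1 - b) else 0)"
proof -
  have "((\<lambda>x. \<Gamma>\<^sub>0$i$j$k + \<Gamma>\<^sub>1$i$j$k * (x - b) + \<Gamma>\<^sub>2$i$j$k * (x - b)\<^sup>2)
    has_real_derivative \<Gamma>\<^sub>1$i$j$k + 2 * \<Gamma>\<^sub>2$i$j$k * (p$1 - b)) (at (p$1))"
    by (auto intro!: derivative_eq_intros)
  from partial_deriv_function_of_coord[OF this] show ?thesis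
    by (simp add: christoffel[abs_def])
qed

text \<open>The matrix on the right is the base form minus \<open>c\<close> times the square of
  \<open>dz + a dx - u dy\<close>: the Ricci tensor has opposite signs along the base and along the
  centre.\<close>

lemma sum_curvature:
  fixes p :: "real^3"
  defines "u \<equiv> p$1 - b"
  shows "(\<Sum>i\<in>UNIV. curvature g i k i j p) = - c * K / 2 *
    vector [vector [P - c * a\<^sup>2, Q + c * a * u, - c * a],
            vector [Q + c * a * u, R - c * u\<^sup>2, c * u],
            vector [- c * a, c * u, - c]] $ j $ k"
proof -
  \<comment> \<open>With \<open>K\<close> as an indeterminate the \<open>c\<^sup>2\<close> terms carry a factor \<open>K (P R - Q\<^sup>2)\<close>; kept inside \<open>d\<close>,
    it turns the claim into a polynomial identity.\<close>
  define d where "d = c * (K * (P * R - Q\<^sup>2))"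
  have "(\<Sum>i\<in>UNIV. curvature g i k i j p) = - c * K / 2 *
    vector [vector [P - d * a\<^sup>2, Q + d * a * u, - d * a],
            vector [Q + d * a * u, R - d * u\<^sup>2, d * u],
            vector [- d * a, d * u, - d]] $ j $ k"
    using exhaust_3[of j] exhaust_3[of k]
    unfolding curvature_def partial_deriv_christoffel christoffel sum_3 u_def[symmetric]
      \<Gamma>\<^sub>0_def \<Gamma>\<^sub>1_def \<Gamma>\<^sub>2_def d_def
    by (elim disjE; simp; simp add: field_simps power2_eq_square)
  moreover have "d = c"
    by (simp add: d_def K)
  ultimately show ?thesis by simp
qed

lemma ricci:
  "ricci g p v w = 
    c\<^sup>2 * K / 2 * (v$3 + a * v$1 - (p$1 - b) * v$2) * (w$3 + a * w$1 - (p$1 - b) * w$2)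
    - c * K / 2 * (P * v$1 * w$1 + Q * (v$1 * w$2 + v$2 * w$1) + R * v$2 * w$2)"
  unfolding ricci_def sum_curvature sum_3
  by (simp add: field_simps power2_eq_square)

end

section \<open>Left invariant fields\<close>

lemma nil3_mult_has_derivative:
  "(nil3_mult p has_derivative (\<lambda>v. vector [v$1, v$2, v$3 + p$1 * v$2])) (at q)" (is "(_ has_derivative ?L) _")
proof -
  have "linear ?L"
    by (rule linearI) (auto simp: vec_eq_iff forall_3 algebra_simps)
  then have "((\<lambda>q. p + ?L q) has_derivative (\<lambda>v. 0 + ?L v)) (at q)"
    by (intro has_derivative_add has_derivative_const linear_imp_has_derivative)
  moreover have "nil3_mult p = (\<lambda>q. p + ?L q)"
    by (auto simp: nil3_mult_def vec_eq_iff forall_3)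
  ultimately show ?thesis by simp
qed

text \<open>Left invariance is used at the unit element, which is 0 in the chart.\<close>

lemma left_invariant_eq:
  assumes "left_invariant X"
  shows "X p = vector [X 0$1, X 0$2, X 0$3 + p$1 * X 0$2]"
proof -
  have "nil3_mult p 0 = p"
    by (simp add: nil3_mult_def vec_eq_iff forall_3)
  moreover have "X (nil3_mult p 0) = frechet_derivative (nil3_mult p) (at 0) (X 0)"
    using assms by (simp add: left_invariant_def)
  ultimately show ?thesis
    by (simp add: frechet_derivative_at[OF nil3_mult_has_derivative, symmetric])
qed

lemma left_invariant_has_derivative:
  assumes "left_invariant X"
  shows "(X has_derivative (\<lambda>h. vector [0, 0, h$1 * X 0$2])) (at p)" (is "(_ has_derivative ?L) _")
proof -
  have "linear ?L"
    by (rule linearI) (auto simp: vec_eq_iff forall_3 algebra_simps)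
  then have "((\<lambda>p. X 0 + ?L p) has_derivative (\<lambda>h. 0 + ?L h)) (at p)"
    by (intro has_derivative_add has_derivative_const linear_imp_has_derivative)
  moreover have "X = (\<lambda>p. X 0 + ?L p)"
    by (rule ext, subst left_invariant_eq[OF assms]) (auto simp: vec_eq_iff forall_3)
  ultimately show ?thesis by simp
qed

text \<open>Only the third component of a left invariant field varies, and only with the first
  coordinate; so brackets point along the centre.\<close>

lemma lie_bracket_left_invariant:
  assumes "left_invariant X" "left_invariant Y"
  shows "lie_bracket X Y p = vector [0, 0, X 0$1 * Y 0$2 - X 0$2 * Y 0$1]"
proof -
  have "X p$1 = X 0$1" "Y p$1 = Y 0$1"
    using left_invariant_eq[OF assms(1), of p] left_invariant_eq[OF assms(2), of p] by (metis vector_3(1))+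
  then show ?thesis
    unfolding lie_bracket_def
      frechet_derivative_at[OF left_invariant_has_derivative[OF assms(1)], symmetric]
      frechet_derivative_at[OF left_invariant_has_derivative[OF assms(2)], symmetric]
    by (auto simp: vec_eq_iff forall_3)
qed

section \<open>Milnor frames\<close>

locale milnor =
  fixes F :: "3 \<Rightarrow> 3 vec_field" and \<theta> :: "3 \<Rightarrow> real^3 \<Rightarrow> real^3 \<Rightarrow> real"
  assumes milnor_frame: "milnor_frame F \<theta>"
begin

text \<open>\<open>z\<close> is the central component of \<open>F 1\<close>; \<open>\<delta>\<close>
  is the determinant of the horizontal parts of \<open>F 2\<close> and \<open>F 3\<close>, that is,
  the third component of their bracket.\<close>

definition "z = F 1 0 $ 3"
definition "\<delta> = F 2 0 $ 1 * F 3 0 $ 2 - F 2 0 $ 2 * F 3 0 $ 1"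

lemma left_invariant: "left_invariant (F i)"
  using milnor_frame by (simp add: milnor_frame_def)

lemma dual: "linear (\<theta> i p)" "\<theta> i p (F j p) = (if i = j then 1 else 0)"
  using milnor_frame by (auto simp: milnor_frame_def dual_coframe_def)

lemma frame_nonzero: "F i p \<noteq> 0"
proof
  assume "F i p = 0"
  then show False
    using dual(2)[of i p i] linear_0[OF dual(1), of i p] by simp
qed

text \<open>The normalized bracket makes \<open>F 1\<close> central with
  \<open>z = \<sigma> * \<delta> / 2\<close>; squaring removes the sign
  \<open>\<sigma>\<close>.\<close>

lemma F_1: "F 1 p = vector [0, 0, z]" and z_square: "z\<^sup>2 = \<delta>\<^sup>2 / 4"
proof -
  obtain \<sigma> :: real where \<sigma>: "\<sigma> = 1 \<or> \<sigma> = - 1" "\<And>p. lie_bracket (F 2) (F 3) p = (2 * \<sigma>) *\<^sub>R F 1 p"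
    using milnor_frame unfolding milnor_frame_def by blast
  then have eq: "(2 * \<sigma>) *\<^sub>R F 1 p = vector [0, 0, \<delta>]" for p
    using lie_bracket_left_invariant[OF left_invariant left_invariant, of 2 3 p] by (simp add: \<delta>_def)
  then have "2 * \<sigma> * F 1 p $ 1 = 0" "2 * \<sigma> * F 1 p $ 2 = 0" "2 * \<sigma> * F 1 p $ 3 = \<delta>" for p
    using vector_3 by (metis vector_scaleR_component real_scaleR_def)+
  from this[of p] this[of 0] have *: "F 1 p $ 1 = 0" "F 1 p $ 2 = 0" "F 1 p $ 3 = \<sigma> * \<delta> / 2"
    "F 1 0 $ 3 = \<sigma> * \<delta> / 2"
    using \<sigma>(1) by auto
  then show "F 1 p = vector [0, 0, z]"
    by (simp add: vec_eq_iff forall_3 z_def)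
  show "z\<^sup>2 = \<delta>\<^sup>2 / 4"
    using \<sigma>(1) by (auto simp: z_def * power_divide)
qed

lemma z_nonzero: "z \<noteq> 0"
  using frame_nonzero[of 1 0] F_1[of 0] by (auto simp: vec_eq_iff forall_3)

lemma \<delta>_nonzero: "\<delta> \<noteq> 0"
  using z_nonzero z_square by auto

text \<open>The dual coframe reads off the coordinates of \<open>v\<close> in the frame. Since
  \<open>F 1\<close> is central, Cramer's rule on the first two components gives \<open>c2\<close>
  and \<open>c3\<close>; the third component then gives the coefficient of
  \<open>F 1\<close>.\<close>

lemma coframe:
  fixes v :: "real^3"
  defines "c2 \<equiv> (v$1 * F 3 0$2 - v$2 * F 3 0$1) / \<delta>"
    and "c3 \<equiv> (F 2 0$1 * v$2 - F 2 0$2 * v$1) / \<delta>"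
  shows "\<theta> 2 p v = c2" "\<theta> 3 p v = c3"
    "\<theta> 1 p v = (v$3 - c2 * (F 2 0$3 + p$1 * F 2 0$2) - c3 * (F 3 0$3 + p$1 * F 3 0$2)) / z"
proof -
  define c1 where "c1 = (v$3 - c2 * (F 2 0$3 + p$1 * F 2 0$2) - c3 * (F 3 0$3 + p$1 * F 3 0$2)) / z"
  have "v$1 = c2 * F 2 0$1 + c3 * F 3 0$1" "v$2 = c2 * F 2 0$2 + c3 * F 3 0$2"
    unfolding c2_def c3_def using \<delta>_nonzero
    by (simp_all add: field_simps) (simp_all add: \<delta>_def algebra_simps)
  moreover have "v$3 = c1 * z + c2 * (F 2 0$3 + p$1 * F 2 0$2) + c3 * (F 3 0$3 + p$1 * F 3 0$2)"
    using z_nonzero by (simp add: c1_def)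
  ultimately have "v = c1 *\<^sub>R F 1 p + c2 *\<^sub>R F 2 p + c3 *\<^sub>R F 3 p"
    by (simp add: F_1 left_invariant_eq[OF left_invariant, of 2 p] left_invariant_eq[OF left_invariant, of 3 p]
        vec_eq_iff forall_3)
  then have "\<theta> i p v = c1 * \<theta> i p (F 1 p) + c2 * \<theta> i p (F 2 p) + c3 * \<theta> i p (F 3 p)" for i
    using dual(1)[of i p] by (simp add: linear_add linear_cmul)
  then show "\<theta> 2 p v = c2" "\<theta> 3 p v = c3"
    "\<theta> 1 p v = (v$3 - c2 * (F 2 0$3 + p$1 * F 2 0$2) - c3 * (F 3 0$3 + p$1 * F 3 0$2)) / z"
    by (simp_all add: dual(2) c1_def)
qed

text \<open>The parameters that bring a diagonal metric into the form of
  \<open>heisenberg_metric\<close>: \<open>z\<close> times the first coframe element is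
  \<open>dz + a dx - (x - b) dy\<close>, and \<open>P\<close>, \<open>Q\<close>, \<open>R\<close>
  are the coefficients of the part with \<open>B\<close> and \<open>C\<close>. The remaining
  parameter \<open>c\<close> is \<open>A / z\<^sup>2\<close>.\<close>

definition "a = (F 2 0$2 * F 3 0$3 - F 3 0$2 * F 2 0$3) / \<delta>"
definition "b = (F 3 0$1 * F 2 0$3 - F 2 0$1 * F 3 0$3) / \<delta>"
definition "P B C = (B * (F 3 0$2)\<^sup>2 + C * (F 2 0$2)\<^sup>2) / \<delta>\<^sup>2"
definition "Q B C = - (B * F 3 0$1 * F 3 0$2 + C * F 2 0$1 * F 2 0$2) / \<delta>\<^sup>2"
definition "R B C = (B * (F 3 0$1)\<^sup>2 + C * (F 2 0$1)\<^sup>2) / \<delta>\<^sup>2"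

lemma coframe_1: "z * \<theta> 1 p v = v$3 + a * v$1 - (p$1 - b) * v$2"
proof -
  have "z * \<theta> 1 p v = v$3 - ((v$1 * F 3 0$2 - v$2 * F 3 0$1) * (F 2 0$3 + p$1 * F 2 0$2)
    + (F 2 0$1 * v$2 - F 2 0$2 * v$1) * (F 3 0$3 + p$1 * F 3 0$2)) / \<delta>"
    using z_nonzero by (simp add: coframe add_divide_distrib)
  \<comment> \<open>The coefficient of \<open>p$1 * v$2\<close> is
    \<open>\<delta> / \<delta>\<close> up to sign; it is left unreduced so that all fractions share
    one denominator.\<close>
  also have "\<dots> = v$3 + a * v$1 - (p$1 * (\<delta> / \<delta>) - b) * v$2"
    using \<delta>_nonzero by (simp add: a_def b_def field_simps) (simp add: \<delta>_def algebra_simps)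
  finally show ?thesis
    using \<delta>_nonzero by simp
qed

lemma base_form:
  "B * (\<theta> 2 p v * \<theta> 2 p w) + C * (\<theta> 3 p v * \<theta> 3 p w)
    = P B C * v$1 * w$1 + Q B C * (v$1 * w$2 + v$2 * w$1) + R B C * v$2 * w$2"
  using \<delta>_nonzero
  by (simp add: coframe P_def Q_def R_def field_simps power2_eq_square)

text \<open>The coframe elements 2 and 3, as covectors in \<open>dx\<close> and \<open>dy\<close>,
  have determinant \<open>1 / \<delta>\<close>, which enters squared.\<close>

lemma base_det: "P B C * R B C - (Q B C)\<^sup>2 = B * C / \<delta>\<^sup>2"
proof -
  have *: "x / d * (y / d) - (- q / d)\<^sup>2 = (x * y - q\<^sup>2) / d / d" if "d \<noteq> 0" for x y q d :: real
    using that by (simp add: field_simps power2_eq_square)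
  have "P B C * R B C - (Q B C)\<^sup>2 = ((B * (F 3 0$2)\<^sup>2 + C * (F 2 0$2)\<^sup>2) * (B * (F 3 0$1)\<^sup>2 + C * (F 2 0$1)\<^sup>2)
    - (B * F 3 0$1 * F 3 0$2 + C * F 2 0$1 * F 2 0$2)\<^sup>2) / \<delta>\<^sup>2 / \<delta>\<^sup>2"
    unfolding P_def Q_def R_def using \<delta>_nonzero by (intro *) simp
  also have "\<dots> = B * C * \<delta>\<^sup>2 / \<delta>\<^sup>2 / \<delta>\<^sup>2"
    by (simp add: \<delta>_def power2_eq_square algebra_simps)
  finally show ?thesis
    using \<delta>_nonzero by simp
qed

section \<open>Curvature, volume and inverse of a diagonal metric\<close>

context
  fixes A B C :: real
  assumes pos: "A > 0" "B > 0" "C > 0"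
begin

abbreviation "g \<equiv> diagonal_metric \<theta> A B C"

lemma metric_eq:
  "g p v w = A / z\<^sup>2 * (v$3 + a * v$1 - (p$1 - b) * v$2) * (w$3 + a * w$1 - (p$1 - b) * w$2)
    + P B C * v$1 * w$1 + Q B C * (v$1 * w$2 + v$2 * w$1) + R B C * v$2 * w$2"
  using z_nonzero base_form[of B p v w C]
  by (simp add: diagonal_metric_def coframe_1[symmetric] power2_eq_square)

lemma heisenberg_metric: "heisenberg_metric g a b (A / z\<^sup>2) (P B C) (Q B C) (R B C)"
proof
  show "A / z\<^sup>2 \<noteq> 0" "P B C * R B C - (Q B C)\<^sup>2 \<noteq> 0"
    using pos z_nonzero \<delta>_nonzero by (auto simp: base_det)
  fix p
  show "gram g p =
    vector [vector [P B C + A / z\<^sup>2 * a\<^sup>2, Q B C - A / z\<^sup>2 * a * (p$1 - b), A / z\<^sup>2 * a],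
            vector [Q B C - A / z\<^sup>2 * a * (p$1 - b), R B C + A / z\<^sup>2 * (p$1 - b)\<^sup>2, - (A / z\<^sup>2) * (p$1 - b)],
            vector [A / z\<^sup>2 * a, - (A / z\<^sup>2) * (p$1 - b), A / z\<^sup>2]]"
    using z_nonzero
    by (simp add: gram_def metric_eq vec_eq_iff forall_3 axis_def) (simp add: field_simps power2_eq_square)
qed

interpretation heisenberg_metric g a b "A / z\<^sup>2" "P B C" "Q B C" "R B C"
  by (rule heisenberg_metric)

lemma ricci_diagonal_metric:
  "ricci g p v w = 2 * A\<^sup>2 / (B * C) * (\<theta> 1 p v * \<theta> 1 p w)
    - 2 * A / C * (\<theta> 2 p v * \<theta> 2 p w) - 2 * A / B * (\<theta> 3 p v * \<theta> 3 p w)"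
proof -
  \<comment> \<open>Here the normalization of the bracket enters, through \<open>z_square\<close>;
    it produces the constants 2 in the Ricci tensor.\<close>
  have K_eq: "K = 4 * z\<^sup>2 / (B * C)"
    using z_square by (simp add: K_def base_det)
  have "ricci g p v w = (A / z\<^sup>2)\<^sup>2 * K / 2 * (z * \<theta> 1 p v) * (z * \<theta> 1 p w)
    - A / z\<^sup>2 * K / 2 * (B * (\<theta> 2 p v * \<theta> 2 p w) + C * (\<theta> 3 p v * \<theta> 3 p w))"
    unfolding ricci coframe_1 base_form ..
  also have "\<dots> = 2 * A\<^sup>2 / (B * C) * (\<theta> 1 p v * \<theta> 1 p w)
    - 2 * A / C * (\<theta> 2 p v * \<theta> 2 p w) - 2 * A / B * (\<theta> 3 p v * \<theta> 3 p w)"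
    unfolding K_eq using pos z_nonzero by (simp add: field_simps power2_eq_square)
  finally show ?thesis .
qed

text \<open>Left translations have Jacobian 1 in the chart, so a left invariant density is
  constant.\<close>

lemma volume_density_diagonal_metric: "volume_density g p = sqrt (A * B * C) / (\<bar>z\<bar> * \<bar>\<delta>\<bar>)"
proof -
  have "det (gram g p) = A / z\<^sup>2 * (P B C * R B C - (Q B C)\<^sup>2)"
    by (rule det_gram)
  also have "\<dots> = A * B * C / (z * \<delta>)\<^sup>2"
    by (simp add: base_det power_mult_distrib)
  finally show ?thesis
    by (simp add: volume_density_def real_sqrt_divide abs_mult)
qed

text \<open>The Gram matrix is \<open>transpose T ** D ** T\<close> with \<open>T\<close> the
  coframe in coordinates, and the frame \<open>N\<close> inverts \<open>T\<close>. This form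
  diagonalizes the inverse metrics of the whole flow in one frame and so makes them
  comparable.\<close>

lemma gram_inv_diagonal_metric:
  "gram_inv g p = (\<chi> i j. \<Sum>k\<in>UNIV. F k p$i * F k p$j / vector [A, B, C]$k)"
proof -
  let ?a = "vector [A, B, C] :: real^3"
  define T :: "real^3^3" where "T = (\<chi> k j. \<theta> k p (axis j 1))"
  define N :: "real^3^3" where "N = (\<chi> j k. F k p$j)"
  define D D' :: "real^3^3" where "D = (\<chi> i j. if i = j then ?a$i else 0)"
    and "D' = (\<chi> i j. if i = j then 1 / ?a$i else 0)"
  have "(T ** N)$k$l = \<theta> k p (F l p)" for k l
  proof -
    have "\<theta> k p (F l p) = \<theta> k p (\<Sum>j\<in>UNIV. F l p$j *\<^sub>R axis j 1)"
      by (simp add: basis_expansion flip: scalar_mult_eq_scaleR)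
    also have "\<dots> = (\<Sum>j\<in>UNIV. F l p$j * \<theta> k p (axis j 1))"
      using dual(1)[of k p] by (simp add: linear_sum linear_cmul)
    finally show ?thesis
      by (simp add: T_def N_def matrix_matrix_mult_def mult.commute)
  qed
  then have TN: "T ** N = mat 1"
    by (simp add: vec_eq_iff mat_def dual(2))
  then have NT: "N ** T = mat 1"
    using matrix_left_right_inverse by blast
  have DD': "D ** D' = mat 1"
    using pos by (auto simp: D_def D'_def matrix_matrix_mult_def mat_def vec_eq_iff forall_3 sum_3)
  have "gram g p = transpose T ** D ** T"
    by (simp add: gram_def diagonal_metric_def T_def D_def matrix_matrix_mult_def transpose_def
        vec_eq_iff forall_3 sum_3 algebra_simps)
  then have "gram g p ** (N ** D' ** transpose N) = transpose T ** D ** (T ** N) ** D' ** transpose N"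
    by (simp add: matrix_mul_assoc)
  also have "\<dots> = transpose T ** (D ** D') ** transpose N"
    by (simp add: TN matrix_mul_assoc)
  also have "\<dots> = mat 1"
    by (simp add: DD' NT flip: matrix_transpose_mul)
  finally have "gram_inv g p = N ** D' ** transpose N"
    unfolding gram_inv_def by (rule matrix_inv_eqI)
  also have "\<dots> = (\<chi> i j. \<Sum>k\<in>UNIV. F k p$i * F k p$j / ?a$k)"
    by (simp add: N_def D'_def matrix_matrix_mult_def transpose_def vec_eq_iff forall_3 sum_3)
  finally show ?thesis .
qed

lemma gram_inv_form: "x \<bullet> (gram_inv g p *v x) = (F 1 p \<bullet> x)\<^sup>2 / A + (F 2 p \<bullet> x)\<^sup>2 / B + (F 3 p \<bullet> x)\<^sup>2 / C"
proof -
  have "x \<bullet> (gram_inv g p *v x) = (\<Sum>k\<in>UNIV. (F k p \<bullet> x)\<^sup>2 / vector [A, B, C]$k)"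
    by (simp add: gram_inv_diagonal_metric inner_vec_def matrix_vector_mult_def sum_3
        add_divide_distrib power2_eq_square algebra_simps)
  then show ?thesis
    by (simp add: sum_3)
qed

lemma transpose_gram_inv: "transpose (gram_inv g p) = gram_inv g p"
  by (simp add: gram_inv_diagonal_metric transpose_def vec_eq_iff mult.commute)

lemma gram_inv_C1: "Ck_on 1 \<Omega> (\<lambda>p. gram_inv g p$i$j)"
proof -
  have const: "Ck_on 1 \<Omega> (\<lambda>p. x)" for x :: real
    by (auto simp: Ck_on_1 partial_deriv_def)
  have "Ck_on 1 \<Omega> (\<lambda>p. F k p$i)" for i k
  proof -
    \<comment> \<open>The components of the frame are affine in \<open>p$1\<close>; only the third
      has a slope.\<close>
    define x y where "x = F k 0$i" and "y = (if i = 3 then F k 0$2 else 0)"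
    have "Ck_on 1 \<Omega> (\<lambda>p::real^3. p$1)"
      using partial_deriv_function_of_coord[OF DERIV_ident, where k = "1::3"]
      by (auto simp: Ck_on_1 intro!: bounded_linear_imp_differentiable bounded_linear_vec_nth)
    then have "Ck_on 1 \<Omega> (\<lambda>p. x + p$1 * y)"
      by (rule Ck_on_1_compose[where \<phi> = "\<lambda>s. x + s * y" and \<phi>' = "\<lambda>_. y"])
        (auto intro!: derivative_eq_intros)
    moreover have "F k p$i = x + p$1 * y" for p
      unfolding left_invariant_eq[OF left_invariant, of k p] x_def y_def
      using exhaust_3[of i] by auto
    ultimately show ?thesis by simp
  qed
  then have "Ck_on 1 \<Omega> (\<lambda>p. \<Sum>k\<in>UNIV. F k p$i * F k p$j * (1 / vector [A, B, C]$k))"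
    by (intro Ck_on_1_sum Ck_on_1_mult const) auto
  then show ?thesis
    by (simp add: gram_inv_diagonal_metric)
qed

text \<open>The constant volume density \<open>\<omega>\<close> leaves the partial derivatives and
  cancels with the denominator of the divergence.\<close>

lemma torsion_function_dirichlet:
  assumes "open \<Omega>" "compact (closure \<Omega>)" "torsion_function g \<Omega> E"
  shows "dirichlet_torsion \<Omega> (gram_inv g) E"
proof
  have C2: "Ck_on 2 \<Omega> E"
    using assms(3) by (simp add: torsion_function_def)
  then show "Ck_on 2 \<Omega> E" .
  show "open \<Omega>" "compact (closure \<Omega>)" "continuous_on (closure \<Omega>) E"
    "\<And>p. p \<in> frontier \<Omega> \<Longrightarrow> E p = 0"
    using assms by (auto simp: torsion_function_def)
  show "Ck_on 1 \<Omega> (\<lambda>p. gram_inv g p$i$j)" for i j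
    by (rule gram_inv_C1)
  show "0 \<le> x \<bullet> (gram_inv g p *v x)" for p x
    using pos by (simp add: gram_inv_form)
  fix p assume p: "p \<in> \<Omega>"
  define \<omega> where "\<omega> = sqrt (A * B * C) / (\<bar>z\<bar> * \<bar>\<delta>\<bar>)"
  have \<omega>: "\<omega> \<noteq> 0"
    using pos z_nonzero \<delta>_nonzero by (simp add: \<omega>_def)
  have diff: "(\<lambda>q. (gram_inv g q *v grad E q)$i) differentiable (at p)" for i
    using Ck_on_1_flux[OF gram_inv_C1 C2] p by (auto simp: Ck_on_1)
  have grad: "gradient g E = (\<lambda>q. gram_inv g q *v grad E q)"
    by (simp add: gradient_def grad_def matrix_vector_mult_def fun_eq_iff)
  have "(\<Sum>i\<in>UNIV. \<omega> * partial_deriv i (\<lambda>q. (gram_inv g q *v grad E q)$i) p) / \<omega> = laplacian g E p"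
    using partial_deriv_mult[OF _ diff, of "\<lambda>_. \<omega>"]
    by (simp add: laplacian_def divergence_def grad volume_density_diagonal_metric partial_deriv_def
        flip: \<omega>_def)
  also have "\<dots> = - 1"
    using assms(3) p by (simp add: torsion_function_def)
  finally show "(\<Sum>i\<in>UNIV. partial_deriv i (\<lambda>q. (gram_inv g q *v grad E q)$i) p) = - 1"
    using \<omega> by (simp flip: sum_distrib_left)
qed

text \<open>The volume measure is a constant multiple of Lebesgue measure, and the constant comes
  out of the integral.\<close>

lemma torsional_rigidity:
  assumes "open \<Omega>" "compact (closure \<Omega>)" "has_torsional_rigidity g \<Omega> \<tau>"
  obtains E where "dirichlet_torsion \<Omega> (gram_inv g) E"
    "\<tau> = sqrt (A * B * C) / (\<bar>z\<bar> * \<bar>\<delta>\<bar>) * (LINT p:\<Omega>|lborel. E p)"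
proof -
  define \<omega> where "\<omega> = sqrt (A * B * C) / (\<bar>z\<bar> * \<bar>\<delta>\<bar>)"
  have "\<omega> \<ge> 0"
    using pos by (simp add: \<omega>_def)
  obtain E where E: "torsion_function g \<Omega> E" "\<tau> = (LINT p:\<Omega>|volume_measure g. E p)"
    using assms(3) by (auto simp: has_torsional_rigidity_def)
  have dir: "dirichlet_torsion \<Omega> (gram_inv g) E"
    using assms(1,2) E(1) by (rule torsion_function_dirichlet)
  then interpret dirichlet_torsion \<Omega> "gram_inv g" E .
  have meas: "(\<lambda>p. indicator \<Omega> p *\<^sub>R E p) \<in> borel_measurable lborel"
    using integrable_solution unfolding set_integrable_def by (rule borel_measurable_integrable)
  have "\<tau> = (\<integral>p. indicator \<Omega> p *\<^sub>R E p \<partial>density lborel (\<lambda>_. ennreal \<omega>))"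
    by (simp add: E(2) set_lebesgue_integral_def volume_measure_def volume_density_diagonal_metric \<omega>_def)
  also have "\<dots> = (\<integral>p. \<omega> *\<^sub>R (indicator \<Omega> p *\<^sub>R E p) \<partial>lborel)"
    using \<open>\<omega> \<ge> 0\<close> by (intro integral_density meas) auto
  also have "\<dots> = \<omega> * (LINT p:\<Omega>|lborel. E p)"
    by (simp add: set_lebesgue_integral_def)
  finally show thesis
    using dir that by (simp add: \<omega>_def)
qed

end

end

section \<open>The flow\<close>

lemma nil3_flow_solution:
  fixes A B C :: "real \<Rightarrow> real"
  assumes A: "\<And>s. s \<ge> 0 \<Longrightarrow> (A has_real_derivative - 4 * (A s)\<^sup>2 / (B s * C s)) (at s within {0..})"
    and B: "\<And>s. s \<ge> 0 \<Longrightarrow> (B has_real_derivative 4 * A s / C s) (at s within {0..})"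
    and C: "\<And>s. s \<ge> 0 \<Longrightarrow> (C has_real_derivative 4 * A s / B s) (at s within {0..})"
    and pos: "\<And>s. s \<ge> 0 \<Longrightarrow> A s > 0" "\<And>s. s \<ge> 0 \<Longrightarrow> B s > 0" "\<And>s. s \<ge> 0 \<Longrightarrow> C s > 0"
    and "t \<ge> 0"
  defines "r \<equiv> (1 + 12 * A 0 / (B 0 * C 0) * t) powr (1 / 3)"
  shows "A t = A 0 / r" "B t = B 0 * r" "C t = C 0 * r"
proof -
  have nz: "A s \<noteq> 0" "B s \<noteq> 0" "C s \<noteq> 0" if "s \<ge> 0" for s
    using pos[OF that] by auto
  have const: "f t = f 0" if "\<And>s. s \<ge> 0 \<Longrightarrow> (f has_real_derivative 0) (at s within {0..})" for f
    using has_field_derivative_zero_constant[of "{0..}" f] that \<open>t \<ge> 0\<close> by force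
  have AB: "A s * B s = A 0 * B 0" if "s \<ge> 0" for s
  proof -
    have *: "((\<lambda>s. A s * B s) has_real_derivative 0) (at s within {0..})" if "s \<ge> 0" for s
      using nz[OF that] by (auto intro!: derivative_eq_intros A B that simp: field_simps power2_eq_square)
    show ?thesis
      using has_field_derivative_zero_constant[of "{0..}" "\<lambda>s. A s * B s"] * that by force
  qed
  have AC: "A s * C s = A 0 * C 0" if "s \<ge> 0" for s
  proof -
    have *: "((\<lambda>s. A s * C s) has_real_derivative 0) (at s within {0..})" if "s \<ge> 0" for s
      using nz[OF that] by (auto intro!: derivative_eq_intros A C that simp: field_simps power2_eq_square)
    show ?thesis
      using has_field_derivative_zero_constant[of "{0..}" "\<lambda>s. A s * C s"] * that by force
  qed
  \<comment> \<open>The derivative of \<open>1 / A ^ 3\<close> is \<open>12 / (A B * (A C))\<close>,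
    which the two conservation laws turn into this constant.\<close>
  define k where "k = 12 / (A 0 * B 0 * (A 0 * C 0))"
  have "1 / A t ^ 3 - k * t = 1 / A 0 ^ 3 - k * 0"
  proof (rule const)
    fix s :: real assume s: "s \<ge> 0"
    have "((\<lambda>s. 1 / A s ^ 3 - k * s) has_real_derivative 12 / (A s * B s * (A s * C s)) - k) (at s within {0..})"
      using nz[OF s] by (auto intro!: derivative_eq_intros A s simp: field_simps power2_eq_square eval_nat_numeral)
    then show "((\<lambda>s. 1 / A s ^ 3 - k * s) has_real_derivative 0) (at s within {0..})"
      by (simp add: k_def AB[OF s] AC[OF s])
  qed
  then have cube: "1 / A t ^ 3 = 1 / A 0 ^ 3 + k * t"
    by linarith
  have "(A 0 / A t) ^ 3 = A 0 ^ 3 * (1 / A t ^ 3)"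
    by (simp add: power_divide)
  also have "\<dots> = A 0 ^ 3 * (1 / A 0 ^ 3 + k * t)"
    by (simp only: cube)
  also have "\<dots> = 1 + 12 * A 0 / (B 0 * C 0) * t"
    using nz[of 0] by (simp add: k_def distrib_left) (simp add: field_simps eval_nat_numeral)
  finally have "(A 0 / A t) ^ 3 = 1 + 12 * A 0 / (B 0 * C 0) * t" .
  then have "r = ((A 0 / A t) ^ 3) powr (1 / 3)"
    unfolding r_def by (rule arg_cong[symmetric])
  also have "(A 0 / A t) ^ 3 = (A 0 / A t) powr 3"
    using pos(1)[of 0] pos(1)[OF \<open>t \<ge> 0\<close>] by simp
  also have "((A 0 / A t) powr 3) powr (1 / 3) = A 0 / A t"
    unfolding powr_powr using pos(1)[of 0] pos(1)[OF \<open>t \<ge> 0\<close>] by simp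
  finally have r: "r = A 0 / A t" .
  show "A t = A 0 / r" "B t = B 0 * r" "C t = C 0 * r"
    using AB[OF \<open>t \<ge> 0\<close>] AC[OF \<open>t \<ge> 0\<close>] nz[of 0] nz[OF \<open>t \<ge> 0\<close>] by (simp_all add: r field_simps)
qed

section \<open>The two bounds along the flow\<close>

theorem theorem6p1:
  fixes F :: "3 \<Rightarrow> real^3 \<Rightarrow> real^3"
    and \<theta> :: "3 \<Rightarrow> real^3 \<Rightarrow> real^3 \<Rightarrow> real"
    and A\<^sub>0 B\<^sub>0 C\<^sub>0 :: real
    and A B C :: "real \<Rightarrow> real"
    and g :: "real \<Rightarrow> real^3 \<Rightarrow> real^3 \<Rightarrow> real^3 \<Rightarrow> real"
    and \<Omega> :: "(real^3) set"
    and t \<T>\<^sub>0 \<T>\<^sub>t :: real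
  assumes "milnor_frame F \<theta>"
    and "A\<^sub>0 > 0" and "B\<^sub>0 > 0" and "C\<^sub>0 > 0"
    and "ricci_flow_on {0..} g"
    and "g 0 = diagonal_metric \<theta> A\<^sub>0 B\<^sub>0 C\<^sub>0"
    and "\<And>s. s \<ge> 0 \<Longrightarrow> g s = diagonal_metric \<theta> (A s) (B s) (C s)"
    and "precompact_smooth_domain \<Omega>"
    and "t \<ge> 0"
    and "has_torsional_rigidity (g 0) \<Omega> \<T>\<^sub>0"
    and "has_torsional_rigidity (g t) \<Omega> \<T>\<^sub>t"
  shows "(1 + 12 * A\<^sub>0 / (B\<^sub>0 * C\<^sub>0) * t) powr (- 1 / 6) * \<T>\<^sub>0 \<le> \<T>\<^sub>t \<and>
         \<T>\<^sub>t \<le> (1 + 12 * A\<^sub>0 / (B\<^sub>0 * C\<^sub>0) * t) powr (1 / 2) * \<T>\<^sub>0"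
proof -
  interpret milnor F \<theta>
    using assms(1) by unfold_locales
  note flow = assms(5) and g = assms(7)
  \<comment> \<open>The coefficients are the squared lengths of the frame vectors, and
    \<open>g s\<close> is a Riemannian metric.\<close>
  have pos: "A s > 0" "B s > 0" "C s > 0" if "s \<ge> 0" for s
  proof -
    have "g s 0 (F k 0) (F k 0) > 0" for k
      using flow that frame_nonzero[of k 0] by (simp add: ricci_flow_on_def riemannian_metric_def)
    from this[of 1] this[of 2] this[of 3] show "A s > 0" "B s > 0" "C s > 0"
      by (simp_all add: g[OF that] diagonal_metric_def dual(2))
  qed
  \<comment> \<open>The flow equation on the fixed vector \<open>F k 0\<close> at the unit element,
    where duality of the coframe isolates one coefficient.\<close>
  have deriv: "((\<lambda>s. g s 0 (F k 0) (F k 0)) has_real_derivative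
      - 2 * ricci (g s) 0 (F k 0) (F k 0)) (at s within {0..})" if "s \<ge> 0" for s k
    using flow that by (simp add: ricci_flow_on_def)
  have "(A has_real_derivative - 4 * (A s)\<^sup>2 / (B s * C s)) (at s within {0..})"
    "(B has_real_derivative 4 * A s / C s) (at s within {0..})"
    "(C has_real_derivative 4 * A s / B s) (at s within {0..})" if "s \<ge> 0" for s
  proof -
    \<comment> \<open>The diagonal form of \<open>g s\<close> is given for \<open>s \<ge> 0\<close>,
      so functions are exchanged within the half-line.\<close>
    have *: "(f has_real_derivative d) (at s within {0..})"
      if "\<And>s. s \<ge> 0 \<Longrightarrow> f s = g s 0 (F k 0) (F k 0)" "d = - 2 * ricci (g s) 0 (F k 0) (F k 0)" for f d k
      unfolding that(2)
      by (rule has_field_derivative_transform_within[where d = 1, OF deriv[OF \<open>s \<ge> 0\<close>]])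
        (use that(1) \<open>s \<ge> 0\<close> in auto)
    note ric = g[OF that] ricci_diagonal_metric[OF pos[OF that]] dual(2)
    show "(A has_real_derivative - 4 * (A s)\<^sup>2 / (B s * C s)) (at s within {0..})"
      by (rule *[of _ 1]) (simp_all add: ric, simp_all add: g diagonal_metric_def dual(2))
    show "(B has_real_derivative 4 * A s / C s) (at s within {0..})"
      by (rule *[of _ 2]) (simp_all add: ric, simp_all add: g diagonal_metric_def dual(2))
    show "(C has_real_derivative 4 * A s / B s) (at s within {0..})"
      by (rule *[of _ 3]) (simp_all add: ric, simp_all add: g diagonal_metric_def dual(2))
  qed
  note solution = nil3_flow_solution[OF this pos \<open>t \<ge> 0\<close>]
  have initial: "A 0 = A\<^sub>0" "B 0 = B\<^sub>0" "C 0 = C\<^sub>0"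
  proof -
    have "diagonal_metric \<theta> (A 0) (B 0) (C 0) 0 (F k 0) (F k 0)
        = diagonal_metric \<theta> A\<^sub>0 B\<^sub>0 C\<^sub>0 0 (F k 0) (F k 0)" for k
      using assms(6) g[of 0] by simp
    from this[of 1] this[of 2] this[of 3] show "A 0 = A\<^sub>0" "B 0 = B\<^sub>0" "C 0 = C\<^sub>0"
      by (simp_all add: diagonal_metric_def dual(2))
  qed
  define s where "s = 1 + 12 * A\<^sub>0 / (B\<^sub>0 * C\<^sub>0) * t"
  define r where "r = s powr (1 / 3)"
  have "s \<ge> 1"
    using assms(2-4) \<open>t \<ge> 0\<close> by (simp add: s_def)
  then have r: "r \<ge> 1"
    by (simp add: r_def ge_one_powr_ge_zero)
  have t: "A t = A\<^sub>0 / r" "B t = B\<^sub>0 * r" "C t = C\<^sub>0 * r"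
    using solution by (simp_all add: initial r_def s_def)
  have \<Omega>: "open \<Omega>" "compact (closure \<Omega>)"
    using assms(8) by (auto simp: precompact_smooth_domain_def)
  define \<omega> where "\<omega> = sqrt (A\<^sub>0 * B\<^sub>0 * C\<^sub>0) / (\<bar>z\<bar> * \<bar>\<delta>\<bar>)"
  have \<omega>: "\<omega> \<ge> 0"
    using assms(2-4) by (simp add: \<omega>_def)
  \<comment> \<open>The product of the three coefficients is multiplied by
    \<open>1 / r * r * r = r\<close>.\<close>
  have \<omega>_t: "sqrt (A t * B t * C t) / (\<bar>z\<bar> * \<bar>\<delta>\<bar>) = sqrt r * \<omega>"
    using r by (simp add: t \<omega>_def flip: real_sqrt_mult)
  obtain u where u: "dirichlet_torsion \<Omega> (gram_inv (g 0)) u" "\<T>\<^sub>0 = \<omega> * (LINT p:\<Omega>|lborel. u p)"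
    using torsional_rigidity[OF assms(2-4) \<Omega>] assms(6,10) unfolding \<omega>_def by metis
  obtain v where v: "dirichlet_torsion \<Omega> (gram_inv (g t)) v" "\<T>\<^sub>t = sqrt r * \<omega> * (LINT p:\<Omega>|lborel. v p)"
    using torsional_rigidity[OF pos[OF \<open>t \<ge> 0\<close>] \<Omega>] g[OF \<open>t \<ge> 0\<close>] assms(11) unfolding \<omega>_t by metis
  have form_0: "x \<bullet> (gram_inv (g 0) p *v x)
      = (F 1 p \<bullet> x)\<^sup>2 / A\<^sub>0 + (F 2 p \<bullet> x)\<^sup>2 / B\<^sub>0 + (F 3 p \<bullet> x)\<^sup>2 / C\<^sub>0" for x p
    unfolding assms(6) using assms(2-4) by (rule gram_inv_form)
  have form_t: "x \<bullet> (gram_inv (g t) p *v x)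
      = r * ((F 1 p \<bullet> x)\<^sup>2 / A\<^sub>0) + (F 2 p \<bullet> x)\<^sup>2 / B\<^sub>0 / r + (F 3 p \<bullet> x)\<^sup>2 / C\<^sub>0 / r" for x p
    unfolding g[OF \<open>t \<ge> 0\<close>] gram_inv_form[OF pos[OF \<open>t \<ge> 0\<close>]] by (simp add: t mult.commute)
  have le_mult: "y / r \<le> r * y" "y / r / r \<le> y" if "y \<ge> 0" for y
  proof -
    have "y * 1 \<le> y * (r * r)"
      using that r mult_mono[of 1 r 1 r] by (intro mult_left_mono) auto
    then show "y / r \<le> r * y" "y / r / r \<le> y"
      using r by (simp_all add: field_simps)
  qed
  \<comment> \<open>With \<open>m = 1 / r\<close> the terms of \<open>F 2\<close> and
    \<open>F 3\<close> agree; that of \<open>F 1\<close> needs \<open>1 / r \<le> r\<close>.\<close>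
  have "(LINT p:\<Omega>|lborel. v p) \<le> (LINT p:\<Omega>|lborel. u p) / (1 / r)"
  proof (rule torsion_comparison[OF u(1) v(1)])
    show "transpose (gram_inv (g 0) p) = gram_inv (g 0) p" for p
      unfolding assms(6) using assms(2-4) by (rule transpose_gram_inv)
    show "1 / r * (x \<bullet> (gram_inv (g 0) p *v x)) \<le> x \<bullet> (gram_inv (g t) p *v x)" for p x
      using le_mult(1)[of "(F 1 p \<bullet> x)\<^sup>2 / A\<^sub>0"] assms(2-4)
      by (simp add: form_0 form_t add_divide_distrib)
  qed (use r in auto)
  then have upper: "(LINT p:\<Omega>|lborel. v p) \<le> r * (LINT p:\<Omega>|lborel. u p)"
    by (simp add: mult.commute)
  \<comment> \<open>With the roles exchanged and again \<open>m = 1 / r\<close>, the terms of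
    \<open>F 1\<close> agree; the others need \<open>1 / r\<^sup>2 \<le> 1\<close>.\<close>
  have "(LINT p:\<Omega>|lborel. u p) \<le> (LINT p:\<Omega>|lborel. v p) / (1 / r)"
  proof (rule torsion_comparison[OF v(1) u(1)])
    show "transpose (gram_inv (g t) p) = gram_inv (g t) p" for p
      unfolding g[OF \<open>t \<ge> 0\<close>] using pos[OF \<open>t \<ge> 0\<close>] by (rule transpose_gram_inv)
    show "1 / r * (x \<bullet> (gram_inv (g t) p *v x)) \<le> x \<bullet> (gram_inv (g 0) p *v x)" for p x
      using le_mult(2)[of "(F 2 p \<bullet> x)\<^sup>2 / B\<^sub>0"] le_mult(2)[of "(F 3 p \<bullet> x)\<^sup>2 / C\<^sub>0"] assms(2-4) r
      by (simp add: form_0 form_t add_divide_distrib)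
  qed (use r in auto)
  then have lower: "(LINT p:\<Omega>|lborel. u p) / r \<le> (LINT p:\<Omega>|lborel. v p)"
    using r by (simp add: field_simps)
  have sqrt_r: "sqrt r = s powr (1 / 6)"
    using \<open>s \<ge> 1\<close> by (simp add: r_def powr_powr flip: powr_half_sqrt)
  \<comment> \<open>The volume contributes the exponent 1/6 and the comparison of solutions
    contributes -1/3 or 1/3.\<close>
  have s_powr: "s powr (- 1 / 6) = sqrt r / r" "s powr (1 / 2) = sqrt r * r"
    unfolding sqrt_r by (simp_all add: r_def flip: powr_diff powr_add)
  have "s powr (- 1 / 6) * \<T>\<^sub>0 = sqrt r * \<omega> * ((LINT p:\<Omega>|lborel. u p) / r)"
    unfolding u(2) s_powr by simp
  also have "\<dots> \<le> \<T>\<^sub>t"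
    unfolding v(2) using lower \<omega> r by (intro mult_left_mono) auto
  finally have lower': "s powr (- 1 / 6) * \<T>\<^sub>0 \<le> \<T>\<^sub>t" .
  have "\<T>\<^sub>t \<le> sqrt r * \<omega> * (r * (LINT p:\<Omega>|lborel. u p))"
    unfolding v(2) using upper \<omega> r by (intro mult_left_mono) auto
  also have "\<dots> = s powr (1 / 2) * \<T>\<^sub>0"
    unfolding u(2) s_powr by simp
  finally show ?thesis
    using lower' by (simp add: s_def)
qed

end
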